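(* Let $Z$ be a countable set in $\mathbb{R}^d\setminus\{0\}$ and let $r_z>R_0$, $z\in Z$, be such that the balls $B(z,r_z)$, $z\in Z$, are pairwise disjoint. Suppose that these balls are regularly located, that is: (a) there exists $\varepsilon>0$ such that $|z-z'|\ge\varepsilon$ for all $z,z'\in Z$, $z\ne z'$; (b) there exists $R>0$ such that $B(x,R)\cap Z\neq\emptyset$ for every $x\in\mathbb{R}^d$; (c) there exists a decreasing function $\phi:[0,\infty)\to(0,\infty)$ such that $r_z=\phi(|z|)$ for every $z\in Z$. Then the union $A:=\bigcup_{z\in Z}B(z,r_z)$ is unavoidable if and only if $$\int_1^\infty\frac{r^{d-1}g(r)}{g(\phi(r))}\,dr=\infty .$$
   Context: Let $d\ge 1$. "Decreasing" means non-increasing. $\mathbb{P}=(P_t)_{t>0}$ is a right continuous Markov semigroup on $\mathbb{R}^d$ (Markov kernels with $P_sP_t=P_{s+t}$, $P_t1=1$, and $\lim_{t\to 0}P_tf(x)=f(x)$ for every $x\in\mathbb{R}^d$ and every continuous $f$ with compact support). A Borel function $v:\mathbb{R}^d\to[0,\infty]$ is $\mathbb{P}$-excessive if $\sup_{t>0}P_tv=v$. It is assumed that the potential kernel $V_0:=\int_0^\infty P_t\,dt$ is given by convolution with a $\mathbb{P}$-excessive function $G_0=g(|\cdot|)$, i.e. $V_0f(x)=\int_{\mathbb{R}^d} G_0(x-y)f(y)\,dy$ for all Borel $f\ge 0$, where $g$ is a decreasing function on $[0,\infty)$ with $0<g<\infty$ on $(0,\infty)$, $\lim_{r\to 0}g(r)=g(0)=\infty$,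 and the following hold. (LD) There are $R_0\ge 0$ and $C_G\ge 1$ such that $d\int_0^r s^{d-1}g(s)\,ds\le C_G\,r^dg(r)$ for all $r>R_0$. (UD) There are $R_1\ge 0$, $\eta_0\in(0,1)$ and $K>1$ such that $g(Kr)\le\eta_0\, g(r)$ for all $r>R_1$. The constant $R_0$ is fixed as in (LD). $B(x,r)$ denotes the open ball with center $x$ and radius $r$. Let $(\Omega,\mathfrak M,\mathfrak M_t,X_t,\theta_t,P^x)$ be a Hunt process on $\mathbb{R}^d$ with transition semigroup $\mathbb{P}$ (such a process exists). For Borel $A\subset\mathbb{R}^d$, $T_A(\omega):=\inf\{t\ge 0: X_t(\omega)\in A\}$. A Borel set $A$ is called unavoidable if $P^x[T_A<\infty]=1$ for every $x\in\mathbb{R}^d$; otherwise it is called avoidable. *)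

theory Defs
  imports "HOL-Probability.Probability"
begin

section \<open>Markov semigroups, excessive functions and the potential kernel\<close>

text \<open>
  A semigroup is a family \<open>P t x\<close> of measures; only the values for \<open>t > 0\<close> matter.
  Elements of \<^term>\<open>prob_algebra borel\<close> are the Borel probability measures, so
  the first clause contains both the kernel property and \<open>P\<^sub>t 1 = 1\<close>.
\<close>

definition right_continuous_markov_semigroup ::
    "(real \<Rightarrow> 'a::euclidean_space \<Rightarrow> 'a measure) \<Rightarrow> bool" where
  "right_continuous_markov_semigroup P \<longleftrightarrow>
     (\<forall>t>0. P t \<in> borel \<rightarrow>\<^sub>M prob_algebra borel) \<and>
     (\<forall>s>0. \<forall>t>0. \<forall>x. P (s + t) x = P s x \<bind> P t) \<and>
     (\<forall>f::'a \<Rightarrow> real. \<forall>x.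
        continuous_on UNIV f \<longrightarrow> compact (closure {y. f y \<noteq> 0}) \<longrightarrow>
        ((\<lambda>t. \<integral>y. f y \<partial>P t x) \<longlongrightarrow> f x) (at_right 0))"

definition excessive ::
    "(real \<Rightarrow> 'a::euclidean_space \<Rightarrow> 'a measure) \<Rightarrow> ('a \<Rightarrow> ennreal) \<Rightarrow> bool" where
  "excessive P v \<longleftrightarrow>
     v \<in> borel_measurable borel \<and> (\<forall>x. (SUP t\<in>{0<..}. \<integral>\<^sup>+y. v y \<partial>P t x) = v x)"

definition potential ::
    "(real \<Rightarrow> 'a::euclidean_space \<Rightarrow> 'a measure) \<Rightarrow> ('a \<Rightarrow> ennreal) \<Rightarrow> 'a \<Rightarrow> ennreal" where
  "potential P f x = (\<integral>\<^sup>+t\<in>{0<..}. (\<integral>\<^sup>+y. f y \<partial>P t x) \<partial>lborel)"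


section \<open>The growth conditions on the radial profile\<close>

definition LD :: "nat \<Rightarrow> real \<Rightarrow> (real \<Rightarrow> ennreal) \<Rightarrow> bool" where
  "LD d R0 g \<longleftrightarrow> R0 \<ge> 0 \<and>
     (\<exists>C::real\<ge>1. \<forall>r>R0.
        of_nat d * (\<integral>\<^sup>+s\<in>{0<..<r}. ennreal (s ^ (d - 1)) * g s \<partial>lborel)
          \<le> ennreal (C * r ^ d) * g r)"

definition UD :: "(real \<Rightarrow> ennreal) \<Rightarrow> bool" where
  "UD g \<longleftrightarrow>
     (\<exists>R1::real\<ge>0. \<exists>\<eta>::real. \<exists>K::real>1. 0 < \<eta> \<and> \<eta> < 1 \<and>
        (\<forall>r>R1. g (K * r) \<le> ennreal \<eta> * g r))"


section \<open>Hunt processes\<close>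

text \<open>
  The state space is \<open>E\<^sub>\<Delta>\<close>, the one-point compactification of \<open>E = \<real>\<^sup>d\<close>, with cemetery
  \<open>\<Delta> =\<close> \<^term>\<open>None\<close>.  Time runs through \<open>[0, \<infinity>]\<close> with \<open>X\<^sub>\<infinity> = \<Delta>\<close>, so that \<open>X\<^sub>T\<close> makes sense for
  stopping times taking the value \<open>\<infinity>\<close>.  (For a conservative transition semigroup the
  lifetime is almost surely infinite under each \<open>P\<^sup>x\<close> with \<open>x \<in> E\<close>.)
\<close>

abbreviation top\<^sub>\<Delta> :: "'a::euclidean_space option topology" where
  "top\<^sub>\<Delta> \<equiv> Alexandroff_compactification euclidean"

definition borel\<^sub>\<Delta> :: "'a::euclidean_space option measure" where
  "borel\<^sub>\<Delta> = sigma UNIV {U. openin top\<^sub>\<Delta> U}"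

text \<open>
  The filtration carries the \<open>\<sigma>\<close>-algebras: \<open>\<MM>\<^sub>t\<close> is \<^term>\<open>sets (F t)\<close> for \<open>t < \<infinity>\<close> and \<open>\<MM>\<close> is
  \<^term>\<open>sets (F \<infinity>)\<close>; the laws \<open>P\<^sup>x\<close>, \<open>x \<in> E\<^sub>\<Delta>\<close>, are the measures \<open>Pr x\<close>.
  The filtration is right continuous but need not be complete.
  Constant stopping times in \<open>strong_markov\<close> give the simple Markov property.
\<close>

locale hunt_process = filtration \<Omega> F
  for \<Omega> :: "'w set" and F :: "ennreal \<Rightarrow> 'w measure" +
  fixes X :: "ennreal \<Rightarrow> 'w \<Rightarrow> 'a::euclidean_space option"
    and \<theta> :: "ennreal \<Rightarrow> 'w \<Rightarrow> 'w"
    and Pr :: "'a option \<Rightarrow> 'w measure"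
  assumes filtration_right_continuous:
      "\<And>t. t < \<infinity> \<Longrightarrow> sets (F t) = (\<Inter>s\<in>{t<..}. sets (F s))"
    and prob_space_Pr: "\<And>x. prob_space (Pr x)"
    and sets_Pr: "\<And>x. sets (Pr x) = sets (F \<infinity>)"
    and adapted: "\<And>t. X t \<in> F t \<rightarrow>\<^sub>M borel\<^sub>\<Delta>"
    and at_infinity: "\<And>\<omega>. \<omega> \<in> \<Omega> \<Longrightarrow> X \<infinity> \<omega> = None"
    and absorbing: "\<And>s t \<omega>. \<omega> \<in> \<Omega> \<Longrightarrow> s \<le> t \<Longrightarrow> X s \<omega> = None \<Longrightarrow> X t \<omega> = None"
    and shift_closed: "\<And>t \<omega>. t < \<infinity> \<Longrightarrow> \<omega> \<in> \<Omega> \<Longrightarrow> \<theta> t \<omega> \<in> \<Omega>"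
    and shift: "\<And>s t \<omega>. t < \<infinity> \<Longrightarrow> \<omega> \<in> \<Omega> \<Longrightarrow> X s (\<theta> t \<omega>) = X (s + t) \<omega>"
    and right_continuous:
      "\<And>t \<omega>. \<omega> \<in> \<Omega> \<Longrightarrow> t < \<infinity> \<Longrightarrow> limitin top\<^sub>\<Delta> (\<lambda>s. X s \<omega>) (X t \<omega>) (at_right t)"
    and left_limits:
      "\<And>t \<omega>. \<omega> \<in> \<Omega> \<Longrightarrow> 0 < t \<Longrightarrow> t < \<infinity> \<Longrightarrow> \<exists>l. limitin top\<^sub>\<Delta> (\<lambda>s. X s \<omega>) l (at_left t)"
    and measurable_law:
      "\<And>t B. t < \<infinity> \<Longrightarrow> B \<in> sets borel\<^sub>\<Delta> \<Longrightarrow>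
         (\<lambda>x. measure (Pr x) {\<omega>\<in>\<Omega>. X t \<omega> \<in> B}) \<in> borel_measurable borel\<^sub>\<Delta>"
    and normal: "\<And>x. AE \<omega> in Pr x. X 0 \<omega> = x"
    and measurable_at_stopping_time:
      "\<And>T. stopping_time F T \<Longrightarrow> (\<lambda>\<omega>. X (T \<omega>) \<omega>) \<in> pre_sigma T \<rightarrow>\<^sub>M borel\<^sub>\<Delta>"
    and strong_markov:
      "\<And>T x t B. stopping_time F T \<Longrightarrow> t < \<infinity> \<Longrightarrow> B \<in> sets borel\<^sub>\<Delta> \<Longrightarrow>
         AE \<omega> in Pr x. T \<omega> < \<infinity> \<longrightarrow>
           real_cond_exp (Pr x) (pre_sigma T) (indicator {\<omega>'\<in>\<Omega>. X (T \<omega>' + t) \<omega>' \<in> B}) \<omega>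
             = measure (Pr (X (T \<omega>) \<omega>)) {\<omega>'\<in>\<Omega>. X t \<omega>' \<in> B}"
    and quasi_left_continuous:
      "\<And>S x. (\<And>n::nat. stopping_time F (S n)) \<Longrightarrow>
         (\<And>\<omega>. \<omega> \<in> \<Omega> \<Longrightarrow> incseq (\<lambda>n. S n \<omega>)) \<Longrightarrow>
         AE \<omega> in Pr x. (SUP n. S n \<omega>) < \<infinity> \<longrightarrow>
           limitin top\<^sub>\<Delta> (\<lambda>n. X (S n \<omega>) \<omega>) (X (SUP n. S n \<omega>) \<omega>) sequentially"

definition has_transition_semigroup ::
    "(ennreal \<Rightarrow> 'w \<Rightarrow> 'a::euclidean_space option) \<Rightarrow> ('a option \<Rightarrow> 'w measure) \<Rightarrow>
     (real \<Rightarrow> 'a \<Rightarrow> 'a measure) \<Rightarrow> bool" where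
  "has_transition_semigroup X Pr P \<longleftrightarrow>
     (\<forall>t>0. \<forall>x. distr (Pr (Some x)) borel\<^sub>\<Delta> (X (ennreal t)) = distr (P t x) borel\<^sub>\<Delta> Some)"

definition hitting_time ::
    "(ennreal \<Rightarrow> 'w \<Rightarrow> 'a option) \<Rightarrow> 'a set \<Rightarrow> 'w \<Rightarrow> ennreal" where
  "hitting_time X A \<omega> = Inf {t. t < \<infinity> \<and> X t \<omega> \<in> Some ` A}"

text \<open>
  Meant for Borel sets \<open>A\<close>.  The quantifier \<open>AE\<close> says that the event \<open>T\<^sub>A < \<infinity>\<close> has probability
  one with respect to the completion of \<open>P\<^sup>x\<close>, in which this event is measurable.
\<close>

definition unavoidable ::
    "(ennreal \<Rightarrow> 'w \<Rightarrow> 'a option) \<Rightarrow> ('a option \<Rightarrow> 'w measure) \<Rightarrow> 'a set \<Rightarrow> bool" where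
  "unavoidable X Pr A \<longleftrightarrow> (\<forall>x. AE \<omega> in Pr (Some x). hitting_time X A \<omega> < \<infinity>)"

end

theory Submission
  imports Defs
begin

text \<open>
  Write \<open>q = g / (g \<circ> \<phi>)\<close>.  This is a decreasing function, and the integral in the criterion is, up
  to a constant, the integral of \<open>q(|x|)\<close> over \<open>|x| > 1\<close>.  Since the centres are separated and
  relatively dense, it diverges exactly when \<open>\<Sum>\<^sub>z q(|z|)\<close> does.  The term \<open>q(|z|) = g(|z|) / g(r\<^sub>z)\<close> is
  comparable to the probability of ever hitting \<open>B(z, r\<^sub>z)\<close> from the origin: by (LD) the potential of
  the normalized indicator of the ball is of order \<open>1\<close> on the ball and nowhere of larger order, and
  of order \<open>g(|y - z|) / g(r\<^sub>z)\<close> at points \<open>y\<close> outside it.  So the statement is a Borel-Cantelli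
  dichotomy for the events that the balls are hit.

  If the sum converges, the sum of the normalized indicators over all of \<open>Z\<close>, multiplied by a
  constant, is a function \<open>f\<close> whose potential is at least \<open>1\<close> on the union \<open>A\<close> of the balls and finite
  at the origin.  The mean of this potential under \<open>P\<^sub>t 0\<close> is the part of the occupation integral
  after time \<open>t\<close>, hence tends to \<open>0\<close>, so the potential is smaller than \<open>1\<close> at some point \<open>y\<close>
  (\<open>exists_potential_less_1\<close>).  A potential that is at least \<open>1\<close> on \<open>A\<close> dominates the hitting
  probability of \<open>A\<close> (\<open>hit_le_potential\<close>), so from \<open>y\<close> the set is missed with positive probability.

  If the sum diverges, let \<open>u\<^sub>n\<close> be the sum of the normalized potentials over the centres with
  \<open>|z| \<le> n\<close>, and let \<open>I\<^sub>n\<close> be the integral of \<open>q(|x|)\<close> over \<open>1 < |x| \<le> n\<close>.  Because \<open>g\<close> and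
  \<open>1 / (g \<circ> \<phi>)\<close> are both decreasing, no point sees much more of the configuration than the origin does:
  \<open>u\<^sub>n \<le> a + b I\<^sub>n\<close> everywhere (\<open>sum_normalized_potential_le\<close>).  Conversely, each fixed point sees a
  fixed fraction of \<open>I\<^sub>n\<close> up to a bounded error (\<open>shell_le_sum_normalized_potential\<close>).  After division
  by its upper bound, \<open>u\<^sub>n\<close> is a potential with values in \<open>[0, 1]\<close>, of a function that vanishes off
  \<open>A\<close>, and at every point it eventually exceeds one constant \<open>\<delta> > 0\<close>.  Such potentials bound from below
  the conditional probability of hitting \<open>A\<close> after time \<open>n\<close> given that it has not been hit before
  (\<open>potential_le_hit\<close>).  This probability being at least \<open>\<delta>\<close> for all \<open>n\<close>, the set \<open>A\<close> is hit almost
  surely (\<open>hits_almost_surely\<close>).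

  Both comparisons of hitting probabilities with potentials rest on the Markov property at constant
  times.  As \<open>A\<close> is open and the paths are right continuous, \<open>A\<close> is hit if and only if it is
  hit at a dyadic time, and along each grid of times the event splits into the events that the first
  hit occurs at a given time of the grid.  The identity that drives the argument is
  \<open>potential_occupation\<close>: on an event of the past of \<open>t\<close>, the mean of the potential of \<open>f\<close> at \<open>X\<^sub>t\<close> is the
  mean of \<open>f(X\<^sub>s)\<close> integrated over \<open>s > t\<close>.
\<close>

section \<open>Radial integrals and separated point sets\<close>

text \<open>
  The image of Lebesgue measure under the norm has density \<open>d \<omega> s\<^sup>d\<^sup>-\<^sup>1\<close>, where \<open>\<omega>\<close> is the volume of the
  unit ball: both measures give \<open>{..a}\<close> the volume of a ball of radius \<open>a\<close>.
\<close>

lemma nn_integral_radial: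
  fixes q :: "real \<Rightarrow> ennreal"
  assumes q: "q \<in> borel_measurable borel"
  shows "(\<integral>\<^sup>+x. q (norm (x::'a::euclidean_space)) \<partial>lborel) =
    ennreal (DIM('a) * unit_ball_vol DIM('a)) *
      (\<integral>\<^sup>+s\<in>{0<..}. ennreal (s ^ (DIM('a) - 1)) * q s \<partial>lborel)"
proof -
  let ?d = "DIM('a)" and ?w = "unit_ball_vol DIM('a)"
  define h where "h s = ennreal (?d * ?w * s ^ (?d - 1)) * indicator {0<..} s" for s :: real
  have h[measurable]: "h \<in> borel_measurable borel"
    unfolding h_def by measurable
  have w: "0 \<le> ?w" by simp
  have "distr lborel borel (norm :: 'a \<Rightarrow> real) = density lborel h"
  proof (rule measure_eqI_generator_eq[where \<Omega> = UNIV and E = "range atMost" and A = "\<lambda>i. {..real i}"])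
    show "Int_stable (range (atMost :: real \<Rightarrow> real set))"
      by (auto simp: Int_stable_def)
    show "sets (distr lborel borel (norm :: 'a \<Rightarrow> real)) = sigma_sets UNIV (range atMost)"
      "sets (density lborel h) = sigma_sets UNIV (range atMost)"
      by (simp_all add: borel_eq_atMost)
    show "(\<Union>i. {..real i}) = UNIV"
      using real_arch_simple by auto
    have norm_eq: "emeasure (distr lborel borel (norm :: 'a \<Rightarrow> real)) {..a} =
        (if 0 \<le> a then ennreal (?w * a ^ ?d) else 0)" for a
    proof -
      have "emeasure (distr lborel borel (norm :: 'a \<Rightarrow> real)) {..a} = emeasure lborel (cball (0::'a) a)"
        by (subst emeasure_distr) (auto intro!: arg_cong[where f = "emeasure lborel"])
      also have "\<dots> = (if 0 \<le> a then ennreal (?w * a ^ ?d) else 0)"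
        by (simp add: emeasure_cball)
      finally show ?thesis .
    qed
    then show "emeasure (distr lborel borel (norm :: 'a \<Rightarrow> real)) {..real i} \<noteq> \<infinity>" for i
      by simp
    have dens_eq: "emeasure (density lborel h) {..a} = (if 0 \<le> a then ennreal (?w * a ^ ?d) else 0)" for a
    proof (cases "0 \<le> a")
      case True
      have "emeasure (density lborel h) {..a} = (\<integral>\<^sup>+s. h s * indicator {..a} s \<partial>lborel)"
        by (subst emeasure_density) auto
      also have "\<dots> = (\<integral>\<^sup>+s. ennreal (?d * ?w * s ^ (?d - 1)) * indicator {0..a} s \<partial>lborel)"
        using AE_lborel_singleton[of "0::real"]
        by (intro nn_integral_cong_AE) (auto simp: h_def indicator_def elim: eventually_mono)
      also have "\<dots> = ?w * a ^ ?d - ?w * 0 ^ ?d"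
        using True w
        by (intro nn_integral_FTC_Icc) (auto intro!: derivative_eq_intros)
      finally show ?thesis using True by simp
    next
      case False
      have zero: "h s * indicator {..a} s = 0" for s
        using False by (cases "s \<le> a") (auto simp: h_def)
      have "emeasure (density lborel h) {..a} = (\<integral>\<^sup>+s. h s * indicator {..a} s \<partial>lborel)"
        by (subst emeasure_density) auto
      then show ?thesis using False by (simp only: zero nn_integral_0_iff if_False nn_integral_const mult_zero_left)
    qed
    show "emeasure (distr lborel borel (norm :: 'a \<Rightarrow> real)) T = emeasure (density lborel h) T"
      if "T \<in> range atMost" for T
      using that norm_eq dens_eq by auto
  qed auto
  then have "(\<integral>\<^sup>+s. q s \<partial>distr lborel borel (norm :: 'a \<Rightarrow> real)) = (\<integral>\<^sup>+s. q s \<partial>density lborel h)"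
    by simp
  also have "\<dots> = (\<integral>\<^sup>+s. h s * q s \<partial>lborel)"
    using q by (subst nn_integral_density) auto
  also have "\<dots> = (\<integral>\<^sup>+s. ennreal (?d * ?w) * (ennreal (s ^ (?d - 1)) * q s * indicator {0<..} s) \<partial>lborel)"
    using w by (intro nn_integral_cong) (auto simp: h_def indicator_def ennreal_mult mult.assoc)
  also have "\<dots> = ennreal (?d * ?w) * (\<integral>\<^sup>+s\<in>{0<..}. ennreal (s ^ (?d - 1)) * q s \<partial>lborel)"
    using q by (subst nn_integral_cmult) auto
  finally show ?thesis
    using q by (simp add: nn_integral_distr)
qed

definition separated_by :: "real \<Rightarrow> 'a::real_normed_vector set \<Rightarrow> bool" where
  "separated_by \<epsilon> Y \<longleftrightarrow> (\<forall>y\<in>Y. \<forall>z\<in>Y. y \<noteq> z \<longrightarrow> \<epsilon> \<le> norm (y - z))"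

lemma separated_by_subset: "separated_by \<epsilon> Y \<Longrightarrow> W \<subseteq> Y \<Longrightarrow> separated_by \<epsilon> W"
  by (auto simp: separated_by_def)

text \<open>
  The sets \<open>D y\<close> lie in the balls of radius \<open>\<epsilon>/2\<close> around separated points, so they are disjoint and
  at most one term contributes at each \<open>x\<close>.
\<close>

lemma sum_separated_le_nn_integral:
  fixes Y :: "'a::euclidean_space set" and D :: "'a \<Rightarrow> 'a set" and f :: "'a \<Rightarrow> ennreal"
  assumes "finite Y" and sep: "separated_by \<epsilon> Y"
    and D: "\<And>y. y \<in> Y \<Longrightarrow> D y \<in> sets borel" "\<And>y. y \<in> Y \<Longrightarrow> D y \<subseteq> ball y (\<epsilon>/2)"
    and m: "\<And>y. y \<in> Y \<Longrightarrow> emeasure lborel (D y) = m"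
    and le: "\<And>y x. y \<in> Y \<Longrightarrow> x \<in> D y \<Longrightarrow> c y \<le> f x"
  shows "m * (\<Sum>y\<in>Y. c y) \<le> (\<integral>\<^sup>+x. f x \<partial>lborel)"
proof -
  have "m * (\<Sum>y\<in>Y. c y) = (\<Sum>y\<in>Y. \<integral>\<^sup>+x. c y * indicator (D y) x \<partial>lborel)"
    using D m by (simp add: sum_distrib_left mult.commute nn_integral_cmult_indicator)
  also have "\<dots> = (\<integral>\<^sup>+x. (\<Sum>y\<in>Y. c y * indicator (D y) x) \<partial>lborel)"
    using D by (subst nn_integral_sum) auto
  also have "\<dots> \<le> (\<integral>\<^sup>+x. f x \<partial>lborel)"
  proof (rule nn_integral_mono)
    fix x
    show "(\<Sum>y\<in>Y. c y * indicator (D y) x) \<le> f x"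
    proof (cases "\<exists>y\<in>Y. x \<in> D y")
      case True
      then obtain y where y: "y \<in> Y" "x \<in> D y" by auto
      have "x \<notin> D z" if "z \<in> Y" "z \<noteq> y" for z
      proof
        assume "x \<in> D z"
        then have "dist z x < \<epsilon>/2" "dist y x < \<epsilon>/2"
          using D(2)[OF y(1)] D(2)[OF that(1)] y(2) by auto
        then have "dist z y < \<epsilon>"
          using dist_triangle_half_r[of x z \<epsilon> y] by (simp add: dist_commute)
        then show False
          using sep that y(1) by (force simp: separated_by_def dist_norm)
      qed
      then have "(\<Sum>z\<in>Y. c z * indicator (D z) x) = (\<Sum>z\<in>{y}. c z * indicator (D z) x)"
        using y \<open>finite Y\<close> by (intro sum.mono_neutral_right) auto
      also have "\<dots> \<le> f x" using le[OF y] y by simp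
      finally show ?thesis .
    next
      case False
      then have "(\<Sum>y\<in>Y. c y * indicator (D y) x) = 0"
        by (intro sum.neutral) auto
      then show ?thesis by simp
    qed
  qed
  finally show ?thesis .
qed

lemma separated_ball_card:
  fixes Y :: "'a::euclidean_space set"
  assumes "0 < \<epsilon>" "separated_by \<epsilon> Y" "Y \<subseteq> ball y \<rho>"
  shows "finite Y \<and> card Y \<le> nat \<lfloor>((\<rho> + \<epsilon>/2) / (\<epsilon>/2)) ^ DIM('a)\<rfloor>"
proof (rule finite_if_finite_subsets_card_bdd)
  fix W assume W: "W \<subseteq> Y" "finite W"
  show "card W \<le> nat \<lfloor>((\<rho> + \<epsilon>/2) / (\<epsilon>/2)) ^ DIM('a)\<rfloor>"
  proof (cases "W = {}")
    case False
    let ?w = "unit_ball_vol DIM('a)"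
    have \<rho>: "0 \<le> \<rho>" using False W assms(3) by (metis ball_eq_empty bot.extremum_uniqueI linorder_not_le nless_le)
    have "ennreal (?w * (\<epsilon>/2) ^ DIM('a)) * (\<Sum>z\<in>W. 1) \<le>
        (\<integral>\<^sup>+x. indicator (ball y (\<rho> + \<epsilon>/2)) x \<partial>lborel)"
    proof (rule sum_separated_le_nn_integral[where D = "\<lambda>z. ball z (\<epsilon>/2)" and \<epsilon> = \<epsilon>])
      show "1 \<le> (indicator (ball y (\<rho> + \<epsilon>/2)) x :: ennreal)" if z: "z \<in> W" "x \<in> ball z (\<epsilon>/2)" for z x
      proof -
        have "dist y z < \<rho>" using z W assms(3) by auto
        then have "dist y x < \<rho> + \<epsilon>/2"
          using z dist_triangle[of y x z] by auto
        then show ?thesis by simp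
      qed
    qed (use W assms in \<open>auto simp: emeasure_ball intro: separated_by_subset\<close>)
    also have "\<dots> = ennreal (?w * (\<rho> + \<epsilon>/2) ^ DIM('a))"
      using \<rho> assms(1) by (simp add: emeasure_ball)
    finally have "?w * (\<epsilon>/2) ^ DIM('a) * card W \<le> ?w * (\<rho> + \<epsilon>/2) ^ DIM('a)"
      using \<rho> assms(1) by (simp add: ennreal_of_nat_eq_real_of_nat ennreal_mult[symmetric])
    then have "?w * ((\<epsilon>/2) ^ DIM('a) * card W) \<le> ?w * (\<rho> + \<epsilon>/2) ^ DIM('a)"
      by (simp add: mult.assoc)
    then have "(\<epsilon>/2) ^ DIM('a) * card W \<le> (\<rho> + \<epsilon>/2) ^ DIM('a)"
      by (rule mult_left_le_imp_le) simp
    then have "card W \<le> (\<rho> + \<epsilon>/2) ^ DIM('a) / (\<epsilon>/2) ^ DIM('a)"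
      using assms(1) by (subst pos_le_divide_eq) (simp_all only: mult.commute zero_less_power half_gt_zero)
    then have "card W \<le> ((\<rho> + \<epsilon>/2) / (\<epsilon>/2)) ^ DIM('a)"
      by (simp only: power_divide)
    then show ?thesis by linarith
  qed simp
qed

text \<open>
  A ball of radius \<open>\<epsilon>/2\<close> around \<open>z\<close> contains one of radius \<open>\<epsilon>/4\<close> that is shifted towards the origin.
  On the latter a decreasing radial function is at least its value at \<open>z\<close>.  In the
  application \<open>q\<close> is \<open>g / (g \<circ> \<phi>)\<close>, which may decay too fast to be comparable with its translates, so
  the comparison has to use monotonicity alone.
\<close>

lemma sum_separated_le_radial_integral:
  fixes Y :: "'a::euclidean_space set" and q :: "real \<Rightarrow> ennreal"
  assumes "finite Y" "0 < \<epsilon>" "separated_by \<epsilon> Y"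
    and q: "antimono_on {0<..} q"
    and Y: "\<And>z. z \<in> Y \<Longrightarrow> 1 + \<epsilon> \<le> norm z" "\<And>z. z \<in> Y \<Longrightarrow> norm z \<le> n"
  shows "ennreal (unit_ball_vol DIM('a) * (\<epsilon>/4) ^ DIM('a)) * (\<Sum>z\<in>Y. q (norm z))
    \<le> (\<integral>\<^sup>+x\<in>{x::'a. 1 < norm x \<and> norm x \<le> n}. q (norm x) \<partial>lborel)"
proof (rule sum_separated_le_nn_integral[where \<epsilon> = \<epsilon>
      and D = "\<lambda>z. ball (z - (\<epsilon>/4 / norm z) *\<^sub>R z) (\<epsilon>/4)"])
  have half: "norm (x - z) < \<epsilon>/2 \<and> norm x < norm z \<and> 1 < norm x"
    if z: "z \<in> Y" and x: "x \<in> ball (z - (\<epsilon>/4 / norm z) *\<^sub>R z) (\<epsilon>/4)" for z x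
  proof -
    let ?p = "z - (\<epsilon>/4 / norm z) *\<^sub>R z"
    have nz: "norm z \<ge> 1 + \<epsilon>" "norm z > 0" using Y(1)[OF z] \<open>0 < \<epsilon>\<close> by auto
    have p: "norm (?p - z) = \<epsilon>/4" using nz \<open>0 < \<epsilon>\<close> by simp
    have "?p = (1 - \<epsilon>/4 / norm z) *\<^sub>R z" by (simp add: algebra_simps)
    then have "norm ?p = \<bar>1 - \<epsilon>/4 / norm z\<bar> * norm z" by simp
    also have "\<dots> = norm z - \<epsilon>/4" using nz \<open>0 < \<epsilon>\<close>
      by (simp add: abs_if field_simps)
    finally have np: "norm ?p = norm z - \<epsilon>/4" .
    have xp: "norm (x - ?p) < \<epsilon>/4" using x by (simp add: dist_norm norm_minus_commute)
    have "norm (x - z) \<le> norm (x - ?p) + norm (?p - z)"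
      using norm_triangle_ineq[of "x - ?p" "?p - z"] by simp
    moreover have "norm x \<le> norm (x - ?p) + norm ?p"
      using norm_triangle_ineq[of "x - ?p" ?p] by simp
    moreover have "norm ?p \<le> norm (x - ?p) + norm x"
      using norm_triangle_ineq[of "?p - x" x] by (simp add: norm_minus_commute)
    ultimately show ?thesis using xp p np nz \<open>0 < \<epsilon>\<close> by linarith
  qed
  show "ball (z - (\<epsilon>/4 / norm z) *\<^sub>R z) (\<epsilon>/4) \<subseteq> ball z (\<epsilon>/2)" if "z \<in> Y" for z
    using half[OF that] by (auto simp: dist_norm norm_minus_commute)
  show "q (norm z) \<le> q (norm x) * indicator {x. 1 < norm x \<and> norm x \<le> n} x"
    if z: "z \<in> Y" and x: "x \<in> ball (z - (\<epsilon>/4 / norm z) *\<^sub>R z) (\<epsilon>/4)" for z x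
    using half[OF z x] Y(2)[OF z] monotone_onD[OF q, of "norm x" "norm z"] by (simp del: zero_less_norm_iff)
qed (use assms in \<open>auto simp: emeasure_ball\<close>)

text \<open>
  Here the shift goes the other way: within distance \<open>R\<close> of the point \<open>(1 - R/|x|) x\<close> there is a
  centre, which is then closer to the origin than \<open>x\<close> and at distance less than \<open>2 R\<close> from \<open>x\<close>.
\<close>

lemma radial_integral_le_sum:
  fixes Z :: "'a::euclidean_space set" and q :: "real \<Rightarrow> ennreal"
  assumes dense: "\<And>x. ball x R \<inter> Z \<noteq> {}" and "0 < R" "0 < L"
    and fin: "finite {z\<in>Z. norm z \<le> n}"
    and q: "antimono_on {0<..} q"
  shows "(\<integral>\<^sup>+x\<in>{x::'a. L + 2*R \<le> norm x \<and> norm x \<le> n}. q (norm x) \<partial>lborel)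
    \<le> ennreal (unit_ball_vol DIM('a) * (2*R) ^ DIM('a)) * (\<Sum>z\<in>{z\<in>Z. L \<le> norm z \<and> norm z \<le> n}. q (norm z))"
proof -
  let ?Y = "{z\<in>Z. L \<le> norm z \<and> norm z \<le> n}"
  have finY: "finite ?Y" by (rule finite_subset[OF _ fin]) auto
  have "(\<integral>\<^sup>+x\<in>{x::'a. L + 2*R \<le> norm x \<and> norm x \<le> n}. q (norm x) \<partial>lborel)
    \<le> (\<integral>\<^sup>+x. (\<Sum>z\<in>?Y. q (norm z) * indicator (ball z (2*R)) x) \<partial>lborel)"
  proof (rule nn_integral_mono)
    fix x :: 'a
    show "q (norm x) * indicator {x. L + 2*R \<le> norm x \<and> norm x \<le> n} x
      \<le> (\<Sum>z\<in>?Y. q (norm z) * indicator (ball z (2*R)) x)"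
    proof (cases "L + 2*R \<le> norm x \<and> norm x \<le> n")
      case True
      let ?p = "(1 - R / norm x) *\<^sub>R x"
      obtain z where z: "z \<in> Z" "norm (?p - z) < R"
        using dense[of ?p] by (auto simp: dist_norm)
      have nx: "norm x > R" "norm x > 0" using True assms(2,3) by auto
      have "norm ?p = \<bar>1 - R / norm x\<bar> * norm x" by simp
      also have "\<dots> = norm x - R" using nx by (simp add: abs_if field_simps)
      finally have np: "norm ?p = norm x - R" .
      have "x - ?p = (R / norm x) *\<^sub>R x" by (simp add: algebra_simps)
      then have xp: "norm (x - ?p) = R" using nx \<open>0 < R\<close> by simp
      have "norm (z - x) \<le> norm (?p - z) + norm (x - ?p)"
        using norm_triangle_ineq[of "z - ?p" "?p - x"] by (simp add: norm_minus_commute)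
      moreover have "norm z \<le> norm (?p - z) + norm ?p"
        using norm_triangle_ineq[of "z - ?p" ?p] by (simp add: norm_minus_commute)
      moreover have "norm x \<le> norm (z - x) + norm z"
        using norm_triangle_ineq[of "x - z" z] by (simp add: norm_minus_commute)
      ultimately have *: "norm (z - x) < 2 * R" "norm z \<le> norm x" "norm z \<ge> L"
        using z(2) xp np True by linarith+
      have "q (norm x) \<le> q (norm z) * indicator (ball z (2*R)) x"
        using * \<open>0 < L\<close> nx monotone_onD[OF q, of "norm z" "norm x"]
        by (simp add: dist_norm norm_minus_commute del: zero_less_norm_iff)
      also have "\<dots> \<le> (\<Sum>z\<in>?Y. q (norm z) * indicator (ball z (2*R)) x)"
        using z(1) * True finY by (intro member_le_sum) auto
      finally show ?thesis using True by simp
    qed simp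
  qed
  also have "\<dots> = (\<Sum>z\<in>?Y. q (norm z) * emeasure lborel (ball z (2*R)))"
    by (subst nn_integral_sum)
      (auto simp: nn_integral_cmult_indicator intro!: borel_measurable_times_ennreal borel_measurable_indicator)
  also have "\<dots> = ennreal (unit_ball_vol DIM('a) * (2*R) ^ DIM('a)) * (\<Sum>z\<in>?Y. q (norm z))"
    using \<open>0 < R\<close> by (simp add: emeasure_ball sum_distrib_left mult.commute)
  finally show ?thesis .
qed

section \<open>The Hunt process in Euclidean space\<close>

lemma sets_borel\<^sub>\<Delta>: "sets borel\<^sub>\<Delta> = sigma_sets UNIV {U. openin top\<^sub>\<Delta> U}"
  by (simp add: borel\<^sub>\<Delta>_def sets_measure_of_conv)

lemma space_borel\<^sub>\<Delta>[simp]: "space borel\<^sub>\<Delta> = UNIV"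
  by (simp add: borel\<^sub>\<Delta>_def space_measure_of_conv)

lemma measurable_Some_borel\<^sub>\<Delta>[measurable]:
  "(Some :: 'a::euclidean_space \<Rightarrow> _) \<in> borel \<rightarrow>\<^sub>M borel\<^sub>\<Delta>"
  unfolding borel\<^sub>\<Delta>_def
proof (rule measurable_measure_of)
  fix U :: "'a option set" assume "U \<in> {U. openin top\<^sub>\<Delta> U}"
  then consider V where "open V" "U = Some ` V" | C where "closed C" "U = insert None (Some ` (UNIV - C))"
    by (auto simp: openin_Alexandroff_compactification)
  then have "open (Some -` U)"
  proof cases
    case (1 V)
    then have "Some -` U = V" by auto
    then show ?thesis using 1 by simp
  next
    case (2 C)
    then have "Some -` U = - C" by auto
    then show ?thesis using 2 by (simp add: open_Compl)
  qed
  then show "Some -` U \<inter> space borel \<in> sets borel" by simp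
qed auto

lemma Some_image_in_borel\<^sub>\<Delta>:
  fixes B :: "'a::euclidean_space set"
  assumes "B \<in> sets borel"
  shows "Some ` B \<in> sets borel\<^sub>\<Delta>"
proof -
  have "B \<in> sigma_sets UNIV {S. open S}"
    using assms by (simp add: borel_def sets_measure_of_conv)
  then show ?thesis
  proof induction
    case (Basic S)
    then show ?case unfolding sets_borel\<^sub>\<Delta> by (intro sigma_sets.Basic) simp
  next
    case Empty
    show ?case by simp
  next
    case (Compl S)
    have "range (Some :: 'a \<Rightarrow> _) \<in> sets borel\<^sub>\<Delta>"
      unfolding sets_borel\<^sub>\<Delta> by (intro sigma_sets.Basic) simp
    then have "range Some - Some ` S \<in> sets borel\<^sub>\<Delta>"
      using Compl.IH by (rule sets.Diff)
    also have "range Some - Some ` S = Some ` (UNIV - S)" by auto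
    finally show ?case .
  next
    case (Union S)
    then show ?case by (auto simp: image_UN)
  qed
qed

lemma measurable_the_borel\<^sub>\<Delta>[measurable]:
  "(the :: 'a::euclidean_space option \<Rightarrow> 'a) \<in> borel\<^sub>\<Delta> \<rightarrow>\<^sub>M borel"
proof (rule measurableI)
  fix B :: "'a set" assume B: "B \<in> sets borel"
  have "UNIV - range (Some :: 'a \<Rightarrow> _) \<in> sets borel\<^sub>\<Delta>"
    using Some_image_in_borel\<^sub>\<Delta>[of UNIV] sets.compl_sets[of "range Some" borel\<^sub>\<Delta>] by simp
  moreover have "UNIV - range (Some :: 'a \<Rightarrow> _) = {None}"
    by (auto simp: image_iff)
  ultimately have "{None :: 'a option} \<in> sets borel\<^sub>\<Delta>" by simp
  then have "Some ` B \<union> (if the None \<in> B then {None} else {}) \<in> sets borel\<^sub>\<Delta>"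
    using Some_image_in_borel\<^sub>\<Delta>[OF B] by (intro sets.Un) auto
  also have "Some ` B \<union> (if the None \<in> B then {None} else {}) = the -` B"
  proof (rule set_eqI)
    fix u :: "'a option"
    show "u \<in> Some ` B \<union> (if the None \<in> B then {None} else {}) \<longleftrightarrow> u \<in> the -` B"
      by (cases u) auto
  qed
  finally show "the -` B \<inter> space borel\<^sub>\<Delta> \<in> sets borel\<^sub>\<Delta>" by simp
qed simp

lemma limitin_Alexandroff_the:
  fixes f :: "'b \<Rightarrow> 'a::euclidean_space option"
  assumes "limitin top\<^sub>\<Delta> f (Some l) G"
  shows "((\<lambda>s. the (f s)) \<longlongrightarrow> l) G"
proof (rule topological_tendstoI)
  fix S assume "open S" "l \<in> S"
  then have "\<forall>\<^sub>F s in G. f s \<in> Some ` S"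
    using assms by (auto simp: limitin_def)
  then show "\<forall>\<^sub>F s in G. the (f s) \<in> S"
    by (rule eventually_mono) auto
qed

text \<open>
  Right continuity is given along extended nonnegative times, whereas the calculations below use
  real times.
\<close>

lemma eventually_at_right_ennreal:
  assumes "0 \<le> t" "eventually Q (at_right (ennreal t))"
  shows "eventually (\<lambda>s. Q (ennreal s)) (at_right t)"
proof -
  obtain b where b: "ennreal t < b" "\<And>y. ennreal t < y \<Longrightarrow> y < b \<Longrightarrow> Q y"
    using assms(2) unfolding eventually_at_right_field
      eventually_at_right[OF ennreal_less_top[of t]] by blast
  obtain c where c: "t < c" "ennreal c \<le> b"
  proof (cases b)
    case (real c)
    then show ?thesis using b(1) assms(1) that[of c] by (simp add: ennreal_less_iff)
  next
    case top
    then show ?thesis using that[of "t + 1"] by simp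
  qed
  show ?thesis
    unfolding eventually_at_right_field
    using c assms(1) b(2)
    by (intro exI[of _ c]) (auto simp: ennreal_less_iff intro!: b(2) elim!: order.strict_trans2[rotated])
qed

text \<open>
  The approximation is strictly from above, so that right continuity applies to it.
\<close>

definition dyadic_above :: "nat \<Rightarrow> real \<Rightarrow> real" where
  "dyadic_above m s = of_int (\<lfloor>s * 2^m\<rfloor> + 1) / 2^m"

lemma dyadic_above_bounds: "s < dyadic_above m s" "dyadic_above m s \<le> s + 1 / 2^m"
  unfolding dyadic_above_def by (simp_all add: field_simps) linarith+

lemma dyadic_above_tendsto: "filterlim (\<lambda>m. dyadic_above m s) (at_right s) sequentially"
proof -
  have "(\<lambda>m. s + (1/2)^m) \<longlonglongrightarrow> s + 0"
    by (intro tendsto_intros LIMSEQ_power_zero) auto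
  then have "(\<lambda>m. dyadic_above m s) \<longlonglongrightarrow> s"
    using dyadic_above_bounds[where s = s]
    by (intro tendsto_sandwich[of "\<lambda>_. s" "\<lambda>m. dyadic_above m s" _ "\<lambda>m. s + (1/2)^m"])
      (auto simp: power_one_over less_imp_le)
  then show ?thesis
    using dyadic_above_bounds(1)[where s = s]
    by (auto simp: filterlim_at intro!: always_eventually less_imp_neq[symmetric])
qed

text \<open>
  The combination of a Hunt process with its transition semigroup \<open>P\<close>.
\<close>

locale hunt_markov = hunt_process \<Omega> F X \<theta> Pr
  for \<Omega> :: "'w set" and F :: "ennreal \<Rightarrow> 'w measure"
    and X :: "ennreal \<Rightarrow> 'w \<Rightarrow> 'a::euclidean_space option"
    and \<theta> :: "ennreal \<Rightarrow> 'w \<Rightarrow> 'w" and Pr :: "'a option \<Rightarrow> 'w measure" +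
  fixes P :: "real \<Rightarrow> 'a \<Rightarrow> 'a measure"
  assumes semigroup: "right_continuous_markov_semigroup P"
    and transition: "has_transition_semigroup X Pr P"
begin

abbreviation law :: "'a \<Rightarrow> 'w measure" where "law x \<equiv> Pr (Some x)"

text \<open>
  The process with values in the space itself.  By conservativeness almost every path stays there
  (\<open>alive\<close>), so the value \<^term>\<open>the None\<close> occurs on a null set only.
\<close>

definition Y :: "real \<Rightarrow> 'w \<Rightarrow> 'a" where "Y t \<omega> = the (X (ennreal t) \<omega>)"

lemma space_Pr[simp]: "space (Pr x) = \<Omega>"
  using sets_eq_imp_space_eq[OF sets_Pr[of x]] by (simp add: space_F)

lemma sets_F_Pr: "E \<in> sets (F t) \<Longrightarrow> E \<in> sets (Pr x)"
  using sets_F_mono[of t \<infinity>] by (auto simp: sets_Pr)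

lemma sets_F_le: "E \<in> sets (F s) \<Longrightarrow> s \<le> t \<Longrightarrow> E \<in> sets (F t)"
  using sets_F_mono[of s t] by auto

lemma subalgebra_F_Pr: "subalgebra (Pr x) (F t)"
  unfolding subalgebra_def using sets_F_Pr by (simp add: space_F subsetI)

lemma subalgebra_F: "s \<le> t \<Longrightarrow> subalgebra (F t) (F s)"
  unfolding subalgebra_def using sets_F_mono by (simp add: space_F)

lemma measurable_X_Pr: "X t \<in> Pr x \<rightarrow>\<^sub>M borel\<^sub>\<Delta>"
  using measurable_from_subalg[OF subalgebra_F_Pr adapted] .

lemma Y_adapted: "Y t \<in> F (ennreal t) \<rightarrow>\<^sub>M borel"
  using measurable_compose[OF adapted measurable_the_borel\<^sub>\<Delta>] by (simp add: Y_def[abs_def])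

lemma Y_adapted_le: "s \<le> t \<Longrightarrow> Y s \<in> F (ennreal t) \<rightarrow>\<^sub>M borel"
  using measurable_from_subalg[OF subalgebra_F Y_adapted] by (simp add: ennreal_leI)

lemma measurable_Y[measurable]: "Y t \<in> Pr x \<rightarrow>\<^sub>M borel"
  using measurable_from_subalg[OF subalgebra_F_Pr Y_adapted] .

lemma P_measurable: "0 < t \<Longrightarrow> P t \<in> borel \<rightarrow>\<^sub>M prob_algebra borel"
  using semigroup by (simp add: right_continuous_markov_semigroup_def)

lemma sets_P: "0 < t \<Longrightarrow> sets (P t x) = sets borel"
  using measurable_space[OF P_measurable, of t x] by (simp add: space_prob_algebra)

lemma prob_space_P: "0 < t \<Longrightarrow> prob_space (P t x)"
  using measurable_space[OF P_measurable, of t x] by (simp add: space_prob_algebra)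

lemma distr_X: "0 < t \<Longrightarrow> distr (law x) borel\<^sub>\<Delta> (X (ennreal t)) = distr (P t x) borel\<^sub>\<Delta> Some"
  using transition by (simp add: has_transition_semigroup_def)

lemma distr_Y:
  assumes "0 < t"
  shows "distr (law x) borel (Y t) = P t x"
proof -
  note [measurable_cong] = sets_P[OF assms]
  have "distr (law x) borel (Y t) = distr (distr (law x) borel\<^sub>\<Delta> (X (ennreal t))) borel the"
    using measurable_X_Pr[of "ennreal t"] by (subst distr_distr) (auto simp: comp_def Y_def[abs_def])
  also have "\<dots> = distr (distr (P t x) borel\<^sub>\<Delta> Some) borel the"
    by (simp add: distr_X assms)
  also have "\<dots> = distr (P t x) borel (\<lambda>y. y)"
    by (subst distr_distr) (auto simp: comp_def)
  also have "\<dots> = P t x"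
    by (rule distr_id2) (simp add: sets_P assms)
  finally show ?thesis .
qed

text \<open>
  At every positive time the law of the process is a probability measure on the space itself.  As
  the cemetery is absorbing, it suffices to consider integer times.
\<close>

lemma alive: "AE \<omega> in law x. \<forall>t\<ge>0. X (ennreal t) \<omega> = Some (Y t \<omega>)"
proof -
  interpret prob_space "law x" by (rule prob_space_Pr)
  have "AE \<omega> in law x. X (ennreal u) \<omega> \<in> range Some" if u: "0 < u" for u
  proof -
    note [measurable_cong] = sets_P[OF u]
    have R: "range (Some :: 'a \<Rightarrow> _) \<in> sets borel\<^sub>\<Delta>"
      by (rule Some_image_in_borel\<^sub>\<Delta>) simp
    have "emeasure (law x) (X (ennreal u) -` range Some \<inter> \<Omega>)
        = emeasure (distr (P u x) borel\<^sub>\<Delta> Some) (range Some)"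
      using R measurable_X_Pr[of "ennreal u"]
      by (subst distr_X[OF u, symmetric]) (auto simp: emeasure_distr)
    also have "\<dots> = emeasure (P u x) (space (P u x))"
      using R by (subst emeasure_distr) (auto intro!: arg_cong[where f = "emeasure _"])
    also have "\<dots> = 1"
      using prob_space_P[OF u, of x] by (simp add: prob_space.emeasure_space_1)
    finally have "prob (X (ennreal u) -` range Some \<inter> \<Omega>) = 1"
      by (simp add: measure_def)
    then show ?thesis
      by (subst (asm) prob_eq_1)
        (use measurable_sets[OF measurable_X_Pr R] in \<open>auto elim: eventually_mono\<close>)
  qed
  then have "AE \<omega> in law x. \<forall>n. X (ennreal (Suc n)) \<omega> \<in> range Some"
    by (subst AE_all_countable) (simp del: of_nat_Suc)
  then show ?thesis
  proof (rule AE_mp, intro AE_I2 impI allI)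
    fix \<omega> t assume \<omega>: "\<omega> \<in> space (law x)" "\<forall>n. X (ennreal (Suc n)) \<omega> \<in> range Some" and t: "(0::real) \<le> t"
    obtain m where "t \<le> real m" using real_arch_simple[of t] by auto
    then obtain n where n: "t \<le> real (Suc n)" by (intro that[of m]) simp
    have "X (ennreal t) \<omega> \<noteq> None"
    proof
      assume "X (ennreal t) \<omega> = None"
      then have "X (ennreal (Suc n)) \<omega> = None"
        using absorbing[of \<omega> "ennreal t" "ennreal (Suc n)"] \<omega>(1) ennreal_leI[OF n]
        by (simp del: of_nat_Suc)
      moreover have "X (ennreal (Suc n)) \<omega> \<in> range Some" using \<omega>(2) by blast
      ultimately show False by auto
    qed
    then show "X (ennreal t) \<omega> = Some (Y t \<omega>)" by (auto simp: Y_def)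
  qed
qed

lemma Y_right_continuous: "AE \<omega> in law x. \<forall>t\<ge>0. ((\<lambda>s. Y s \<omega>) \<longlongrightarrow> Y t \<omega>) (at_right t)"
  using alive
proof (rule AE_mp, intro AE_I2 impI allI)
  fix \<omega> t assume \<omega>: "\<omega> \<in> space (law x)" and alive: "\<forall>t\<ge>0. X (ennreal t) \<omega> = Some (Y t \<omega>)" and t: "(0::real) \<le> t"
  have "((\<lambda>s. the (X s \<omega>)) \<longlongrightarrow> Y t \<omega>) (at_right (ennreal t))"
    using right_continuous[of \<omega> "ennreal t"] \<omega> alive t by (intro limitin_Alexandroff_the) simp
  then show "((\<lambda>s. Y s \<omega>) \<longlongrightarrow> Y t \<omega>) (at_right t)"
    unfolding tendsto_def Y_def
    using eventually_at_right_ennreal[OF t] by blast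
qed

text \<open>
  The strong Markov property at the constant time \<open>t\<close>, integrated over an event of the past.
\<close>

lemma markov_event:
  assumes t: "0 \<le> t" and s: "0 < s" and E: "E \<in> sets (F (ennreal t))" and B: "B \<in> sets borel"
  shows "emeasure (law x) (E \<inter> (Y (t + s) -` B \<inter> \<Omega>))
    = (\<integral>\<^sup>+\<omega>\<in>E. emeasure (P s (Y t \<omega>)) B \<partial>law x)"
proof -
  interpret prob_space "law x" by (rule prob_space_Pr)
  let ?T = "\<lambda>_::'w. ennreal t"
  have T: "stopping_time F ?T" by (rule stopping_time_const)
  have subalg: "subalgebra (law x) (pre_sigma ?T)"
    unfolding subalgebra_def
  proof (intro conjI subsetI)
    fix A assume "A \<in> sets (pre_sigma ?T)"
    from sets_pre_sigmaD[OF T this, of "ennreal t"] show "A \<in> sets (law x)"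
      by (simp add: sets_F_Pr)
  qed (simp add: space_pre_sigma)
  interpret finite_measure_subalgebra "law x" "pre_sigma ?T"
    by unfold_locales (rule subalg)
  have E': "E \<in> sets (pre_sigma ?T)"
  proof (rule sets_pre_sigmaI[OF T])
    show "{\<omega> \<in> E. ennreal t \<le> u} \<in> sets (F u)" for u
      using sets_F_le[OF E] by (cases "ennreal t \<le> u") auto
  qed
  note [measurable] = sets_F_Pr[OF E, of "Some x"]
  have [measurable]: "(\<lambda>y. measure (P s y) B) \<in> borel_measurable borel"
    unfolding measure_def
    using measurable_emeasure_kernel[OF measurable_prob_algebraD[OF P_measurable[OF s]] B] by simp
  have SB: "Some ` B \<in> sets borel\<^sub>\<Delta>" by (rule Some_image_in_borel\<^sub>\<Delta>) fact
  let ?C = "{\<omega>\<in>\<Omega>. X (ennreal t + ennreal s) \<omega> \<in> Some ` B}"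
  have C[measurable]: "?C \<in> sets (law x)"
    using measurable_sets[OF measurable_X_Pr SB, of "ennreal t + ennreal s" "Some x"]
    by (simp add: vimage_def Int_def conj_commute)
  have PB: "measure (Pr (Some y)) {\<omega>'\<in>\<Omega>. X (ennreal s) \<omega>' \<in> Some ` B} = measure (P s y) B" for y
  proof -
    note [measurable_cong] = sets_P[OF s]
    have "measure (Pr (Some y)) {\<omega>'\<in>\<Omega>. X (ennreal s) \<omega>' \<in> Some ` B}
      = measure (distr (law y) borel\<^sub>\<Delta> (X (ennreal s))) (Some ` B)"
      using SB measurable_X_Pr[of "ennreal s"]
      by (subst measure_distr) (auto intro!: arg_cong[where f = "measure _"])
    also have "\<dots> = measure (distr (P s y) borel\<^sub>\<Delta> Some) (Some ` B)"
      by (simp add: distr_X s)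
    also have "\<dots> = measure (P s y) B"
      using SB sets_eq_imp_space_eq[OF sets_P[OF s, of y]]
      by (subst measure_distr) (auto intro!: arg_cong[where f = "measure _"])
    finally show ?thesis .
  qed
  have "AE \<omega> in law x. real_cond_exp (law x) (pre_sigma ?T) (indicator ?C) \<omega> = measure (P s (Y t \<omega>)) B"
    using strong_markov[OF T _ SB, of "ennreal s" "Some x"] alive[of x]
    by (auto simp: PB t elim: eventually_elim2)
  then have AE: "AE \<omega> in law x. indicator E \<omega> *\<^sub>R real_cond_exp (law x) (pre_sigma ?T) (indicator ?C) \<omega>
      = indicator E \<omega> *\<^sub>R measure (P s (Y t \<omega>)) B"
    by (auto elim: eventually_mono)
  have "measure (law x) (E \<inter> ?C) = (\<integral>\<omega>\<in>E. indicator ?C \<omega> \<partial>law x)"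
    unfolding set_lebesgue_integral_def
    by (simp add: indicator_inter_arith[symmetric]) (auto intro!: arg_cong[where f = prob])
  also have "\<dots> = (\<integral>\<omega>\<in>E. real_cond_exp (law x) (pre_sigma ?T) (indicator ?C) \<omega> \<partial>law x)"
    using E' by (intro real_cond_exp_intA) (auto simp: emeasure_eq_measure)
  also have "\<dots> = (\<integral>\<omega>. indicator E \<omega> *\<^sub>R measure (P s (Y t \<omega>)) B \<partial>law x)"
    unfolding set_lebesgue_integral_def
    using subalg by (intro integral_cong_AE AE) (auto intro: measurable_from_subalg)
  finally have *: "measure (law x) (E \<inter> ?C) = (\<integral>\<omega>. indicator E \<omega> *\<^sub>R measure (P s (Y t \<omega>)) B \<partial>law x)" .
  have bound: "measure (P s y) B \<le> 1" for y
    using prob_space_P[OF s, of y] by (simp add: prob_space.prob_le_1)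
  have int: "integrable (law x) (\<lambda>\<omega>. indicator E \<omega> *\<^sub>R measure (P s (Y t \<omega>)) B)"
    using bound by (intro integrable_const_bound[where B = 1]) (auto simp: indicator_def)
  have "emeasure (law x) (E \<inter> (Y (t + s) -` B \<inter> \<Omega>)) = emeasure (law x) (E \<inter> ?C)"
  proof (rule emeasure_eq_AE)
    show "AE \<omega> in law x. (\<omega> \<in> E \<inter> (Y (t + s) -` B \<inter> \<Omega>)) = (\<omega> \<in> E \<inter> ?C)"
      using alive[of x] t s
      by (auto elim!: eventually_mono simp flip: ennreal_plus dest: spec[of _ "t + s"])
    show "E \<inter> (Y (t + s) -` B \<inter> \<Omega>) \<in> sets (law x)"
      using measurable_sets[OF measurable_Y B, of "t + s" "Some x"] by auto
  qed auto
  also have "\<dots> = ennreal (\<integral>\<omega>. indicator E \<omega> *\<^sub>R measure (P s (Y t \<omega>)) B \<partial>law x)"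
    by (simp add: emeasure_eq_measure *)
  also have "\<dots> = (\<integral>\<^sup>+\<omega>. ennreal (indicator E \<omega> *\<^sub>R measure (P s (Y t \<omega>)) B) \<partial>law x)"
    using int by (intro nn_integral_eq_integral[symmetric]) auto
  also have "\<dots> = (\<integral>\<^sup>+\<omega>\<in>E. emeasure (P s (Y t \<omega>)) B \<partial>law x)"
    using prob_space_P[OF s]
    by (intro nn_integral_cong)
      (auto simp: indicator_def prob_space_def finite_measure.emeasure_eq_measure)
  finally show ?thesis .
qed

lemma nn_integral_P_measurable[measurable]:
  assumes "0 < s" "v \<in> borel_measurable borel"
  shows "(\<lambda>y. \<integral>\<^sup>+z. v z \<partial>P s y) \<in> borel_measurable borel"
  using measurable_compose[OF measurable_prob_algebraD[OF P_measurable[OF assms(1)]]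
      nn_integral_measurable_subprob_algebra[OF assms(2)]] .

lemma markov:
  assumes t: "0 \<le> t" and s: "0 < s" and E: "E \<in> sets (F (ennreal t))"
    and v: "v \<in> borel_measurable borel"
  shows "(\<integral>\<^sup>+\<omega>\<in>E. v (Y (t + s) \<omega>) \<partial>law x) = (\<integral>\<^sup>+\<omega>\<in>E. (\<integral>\<^sup>+z. v z \<partial>P s (Y t \<omega>)) \<partial>law x)"
proof -
  let ?D = "density (law x) (indicator E)"
  note [measurable] = sets_F_Pr[OF E, of "Some x"] v
  have P: "P s \<in> distr ?D borel (Y t) \<rightarrow>\<^sub>M subprob_algebra borel"
    using measurable_prob_algebraD[OF P_measurable[OF s]] by simp
  have "distr ?D borel (Y (t + s)) = distr ?D borel (Y t) \<bind> P s"
  proof (rule measure_eqI)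
    show sets: "sets (distr ?D borel (Y (t + s))) = sets (distr ?D borel (Y t) \<bind> P s)"
      using sets_bind[of "distr ?D borel (Y t)" "P s" borel] sets_P[OF s] by simp
    fix B :: "'a set" assume "B \<in> sets (distr ?D borel (Y (t + s)))"
    then have B[measurable]: "B \<in> sets borel" by simp
    have PB[measurable]: "(\<lambda>y. emeasure (P s y) B) \<in> borel_measurable borel"
      using measurable_emeasure_kernel[OF measurable_prob_algebraD[OF P_measurable[OF s]] B] .
    have "emeasure (distr ?D borel (Y (t + s))) B = emeasure (law x) (E \<inter> (Y (t + s) -` B \<inter> \<Omega>))"
      using measurable_sets[OF measurable_Y B, of "t + s" "Some x"]
      by (subst emeasure_distr)
        (auto simp: emeasure_density nn_integral_set_ennreal indicator_inter_arith[symmetric])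
    also have "\<dots> = (\<integral>\<^sup>+\<omega>\<in>E. emeasure (P s (Y t \<omega>)) B \<partial>law x)"
      by (rule markov_event) fact+
    also have "\<dots> = (\<integral>\<^sup>+y. emeasure (P s y) B \<partial>distr ?D borel (Y t))"
      by (simp add: nn_integral_distr nn_integral_density mult.commute)
    also have "\<dots> = emeasure (distr ?D borel (Y t) \<bind> P s) B"
      using P B by (intro emeasure_bind[symmetric]) auto
    finally show "emeasure (distr ?D borel (Y (t + s))) B = emeasure (distr ?D borel (Y t) \<bind> P s) B" .
  qed
  then have "(\<integral>\<^sup>+y. v y \<partial>distr ?D borel (Y (t + s))) = (\<integral>\<^sup>+y. v y \<partial>(distr ?D borel (Y t) \<bind> P s))"
    by simp
  also have "\<dots> = (\<integral>\<^sup>+y. \<integral>\<^sup>+z. v z \<partial>P s y \<partial>distr ?D borel (Y t))"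
    by (rule nn_integral_bind[OF v P])
  finally show ?thesis
    using nn_integral_P_measurable[OF s v]
    by (simp add: nn_integral_distr nn_integral_density mult.commute)
qed

subsection \<open>Joint measurability of the transition kernels and occupation times\<close>

text \<open>
  This kernel agrees with \<open>P\<close> at positive times, and being defined for all real times it can be
  treated as a function on a product of Borel spaces.
\<close>

definition Q :: "real \<Rightarrow> 'a \<Rightarrow> 'a measure" where
  "Q s y = distr (law y) borel (Y (max 0 s))"

lemma Q_pos: "0 < s \<Longrightarrow> Q s y = P s y"
  by (simp add: Q_def distr_Y max_def)

lemma sets_Q[measurable_cong, simp]: "sets (Q s y) = sets borel"
  by (simp add: Q_def)

lemma prob_space_Q: "prob_space (Q s y)"
  unfolding Q_def by (intro prob_space.prob_space_distr prob_space_Pr) simp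

lemma nn_integral_Q: "f \<in> borel_measurable borel \<Longrightarrow>
    (\<integral>\<^sup>+z. f z \<partial>Q s y) = (\<integral>\<^sup>+\<omega>. f (Y (max 0 s) \<omega>) \<partial>law y)"
  by (simp add: Q_def nn_integral_distr)

lemma Q_right_continuous:
  fixes f :: "'a \<Rightarrow> real"
  assumes f: "continuous_on UNIV f" "\<And>y. 0 \<le> f y" "\<And>y. f y \<le> 1"
  shows "(\<lambda>m. \<integral>\<^sup>+z. f z \<partial>Q (dyadic_above m (max 0 s)) y) \<longlonglongrightarrow> (\<integral>\<^sup>+z. f z \<partial>Q s y)"
proof -
  interpret prob_space "law y" by (rule prob_space_Pr)
  have [measurable]: "f \<in> borel_measurable borel"
    using f(1) by (rule borel_measurable_continuous_onI)
  have pos: "max 0 (dyadic_above m (max 0 s)) = dyadic_above m (max 0 s)" for m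
    using dyadic_above_bounds(1)[of "max 0 s" m] by simp
  have "(\<lambda>m. \<integral>\<^sup>+\<omega>. f (Y (dyadic_above m (max 0 s)) \<omega>) \<partial>law y) \<longlonglongrightarrow> (\<integral>\<^sup>+\<omega>. f (Y (max 0 s) \<omega>) \<partial>law y)"
  proof (rule nn_integral_dominated_convergence[where w = "\<lambda>_. 1"])
    show "AE \<omega> in law y. (\<lambda>m. ennreal (f (Y (dyadic_above m (max 0 s)) \<omega>))) \<longlonglongrightarrow> ennreal (f (Y (max 0 s) \<omega>))"
      using Y_right_continuous[of y]
    proof (rule eventually_mono)
      fix \<omega> assume "\<forall>t\<ge>0. ((\<lambda>s. Y s \<omega>) \<longlongrightarrow> Y t \<omega>) (at_right t)"
      then have "((\<lambda>s. Y s \<omega>) \<longlongrightarrow> Y (max 0 s) \<omega>) (at_right (max 0 s))" by simp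
      then have "(\<lambda>m. Y (dyadic_above m (max 0 s)) \<omega>) \<longlonglongrightarrow> Y (max 0 s) \<omega>"
        using dyadic_above_tendsto by (rule filterlim_compose)
      moreover have "isCont f (Y (max 0 s) \<omega>)"
        using f(1) by (simp add: continuous_on_eq_continuous_at)
      ultimately have "(\<lambda>m. f (Y (dyadic_above m (max 0 s)) \<omega>)) \<longlonglongrightarrow> f (Y (max 0 s) \<omega>)"
        by (rule isCont_tendsto_compose[rotated])
      then show "(\<lambda>m. ennreal (f (Y (dyadic_above m (max 0 s)) \<omega>))) \<longlonglongrightarrow> ennreal (f (Y (max 0 s) \<omega>))"
        by (rule tendsto_ennrealI)
    qed
    show "(\<integral>\<^sup>+\<omega>. 1 \<partial>law y) < \<infinity>"
      by (simp add: emeasure_eq_measure)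
  qed (use f in \<open>auto intro!: AE_I2\<close>)
  then show ?thesis
    by (simp add: nn_integral_Q pos)
qed

text \<open>
  Right continuity in time holds for integrals of continuous functions; indicators of open sets are
  increasing limits of these.
\<close>

lemma open_indicator_approx:
  fixes U :: "'b::metric_space set"
  assumes "open U" "U \<noteq> UNIV"
  shows "(SUP j::nat. ennreal (min 1 (real j * infdist x (- U)))) = indicator U x"
proof (cases "x \<in> U")
  case False
  then show ?thesis by simp
next
  case True
  have "infdist x (- U) > 0"
    using assms True by (intro infdist_pos_not_in_closed) auto
  then obtain j :: nat where "1 < real j * infdist x (- U)"
    using ex_less_of_nat_mult by blast
  then have "1 \<le> (SUP j::nat. ennreal (min 1 (real j * infdist x (- U))))"
    by (intro SUP_upper2[of j]) auto
  moreover have "(SUP j::nat. ennreal (min 1 (real j * infdist x (- U)))) \<le> 1"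
    by (intro SUP_least) (auto simp: ennreal_le_1)
  ultimately show ?thesis using True by simp
qed

text \<open>
  Integrals of bounded continuous functions against the kernel are right continuous in time, hence
  limits of functions that are constant in time on dyadic intervals.  Indicators of open sets are
  reached by monotone limits.
\<close>

lemma Q_measurable: "(\<lambda>p. Q (fst p) (snd p)) \<in> borel \<Otimes>\<^sub>M borel \<rightarrow>\<^sub>M prob_algebra borel"
proof (rule measurable_prob_algebra_generated[where \<Omega> = UNIV and G = "{U. open U}"])
  show "sets borel = sigma_sets UNIV {U::'a set. open U}"
    by (simp add: borel_def sets_measure_of_conv)
  show "Int_stable {U::'a set. open U}"
    by (auto simp: Int_stable_def)
next
  fix U :: "'a set" assume "U \<in> {U. open U}"
  then have U: "open U" by simp
  show "(\<lambda>p. emeasure (Q (fst p) (snd p)) U) \<in> borel_measurable (borel \<Otimes>\<^sub>M borel)"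
  proof (cases "U = UNIV")
    case True
    have "emeasure (Q s y) UNIV = 1" for s y
      using prob_space.emeasure_space_1[OF prob_space_Q[of s y]] by (simp add: Q_def)
    then show ?thesis by (simp add: True)
  next
    case False
    define f where "f j y = min 1 (real j * infdist y (- U))" for j :: nat and y :: 'a
    have f: "continuous_on UNIV (f j)" "0 \<le> f j y" "f j y \<le> 1" for j y
      unfolding f_def by (auto intro!: continuous_intros simp: infdist_nonneg)
    note [measurable] = borel_measurable_continuous_onI[OF f(1)]
    have Q_f: "(\<lambda>p. \<integral>\<^sup>+z. f j z \<partial>Q (fst p) (snd p)) \<in> borel_measurable (borel \<Otimes>\<^sub>M borel)" for j
    proof (rule borel_measurable_LIMSEQ_order)
      show "(\<lambda>m. \<integral>\<^sup>+z. f j z \<partial>Q (dyadic_above m (max 0 (fst p))) (snd p)) \<longlonglongrightarrow> (\<integral>\<^sup>+z. f j z \<partial>Q (fst p) (snd p))"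
        for p :: "real \<times> 'a"
        using f by (rule Q_right_continuous)
      fix m
      have "(\<lambda>p. \<integral>\<^sup>+z. f j z \<partial>Q (of_nat (nat \<lfloor>max 0 (fst p) * (2::real)^m\<rfloor> + 1) / 2^m) (snd p))
        \<in> borel_measurable (borel \<Otimes>\<^sub>M borel)"
      proof (rule measurable_compose_countable[where
          f = "\<lambda>k p. \<integral>\<^sup>+z. f j z \<partial>Q (of_nat (k + 1) / 2^m) (snd p)"
          and g = "\<lambda>p::real \<times> 'a. nat \<lfloor>max 0 (fst p) * (2::real)^m\<rfloor>"])
        fix k :: nat
        have "(\<lambda>y. \<integral>\<^sup>+z. f j z \<partial>P (of_nat (k + 1) / 2^m) y) \<in> borel_measurable borel"
          by (rule nn_integral_P_measurable) auto
        then have "(\<lambda>y. \<integral>\<^sup>+z. f j z \<partial>Q (of_nat (k + 1) / 2^m) y) \<in> borel_measurable borel"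
          by (subst Q_pos) auto
        then show "(\<lambda>p. \<integral>\<^sup>+z. f j z \<partial>Q (of_nat (k + 1) / 2^m) (snd p)) \<in> borel_measurable (borel \<Otimes>\<^sub>M borel)"
          by (rule measurable_compose[OF measurable_snd])
      qed measurable
      also have "(\<lambda>p. \<integral>\<^sup>+z. f j z \<partial>Q (of_nat (nat \<lfloor>max 0 (fst p) * (2::real)^m\<rfloor> + 1) / 2^m) (snd p))
        = (\<lambda>p::real \<times> 'a. \<integral>\<^sup>+z. f j z \<partial>Q (dyadic_above m (max 0 (fst p))) (snd p))"
        by (auto simp: dyadic_above_def of_nat_nat fun_eq_iff add.commute)
      finally show "(\<lambda>p. \<integral>\<^sup>+z. f j z \<partial>Q (dyadic_above m (max 0 (fst p))) (snd p)) \<in> borel_measurable (borel \<Otimes>\<^sub>M borel)" .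
    qed
    have "emeasure (Q s y) U = (SUP j. \<integral>\<^sup>+z. f j z \<partial>Q s y)" for s y
    proof -
      have "emeasure (Q s y) U = (\<integral>\<^sup>+z. (SUP j. ennreal (f j z)) \<partial>Q s y)"
        using U False by (simp add: f_def open_indicator_approx)
      also have "\<dots> = (SUP j. \<integral>\<^sup>+z. f j z \<partial>Q s y)"
      proof (rule nn_integral_monotone_convergence_SUP)
        show "incseq (\<lambda>j z. ennreal (f j z))"
          unfolding f_def
          by (intro incseq_SucI le_funI ennreal_leI min.mono mult_right_mono) (auto simp: infdist_nonneg)
      qed measurable
      finally show ?thesis .
    qed
    then show ?thesis
      using Q_f by simp
  qed
qed (auto simp: prob_space_Q)

lemma nn_integral_Q_measurable:
  assumes "f \<in> borel_measurable borel" "a \<in> borel_measurable N" "b \<in> N \<rightarrow>\<^sub>M borel"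
  shows "(\<lambda>p. \<integral>\<^sup>+z. f z \<partial>Q (a p) (b p)) \<in> borel_measurable N"
proof -
  have "(\<lambda>p. (a p, b p)) \<in> N \<rightarrow>\<^sub>M borel \<Otimes>\<^sub>M borel"
    using assms by measurable
  from measurable_compose[OF this measurable_compose[OF measurable_prob_algebraD[OF Q_measurable]
      nn_integral_measurable_subprob_algebra[OF assms(1)]]]
  show ?thesis by simp
qed

lemma potential_Q: "potential P f y = (\<integral>\<^sup>+s\<in>{0<..}. (\<integral>\<^sup>+z. f z \<partial>Q s y) \<partial>lborel)"
  unfolding potential_def by (intro nn_integral_cong) (auto simp: Q_pos indicator_def)

lemma potential_measurable[measurable]:
  assumes [measurable]: "f \<in> borel_measurable borel"
  shows "potential P f \<in> borel_measurable borel"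
proof -
  note [measurable] = nn_integral_Q_measurable[OF assms]
  show ?thesis
    unfolding potential_Q[abs_def] by measurable
qed

lemma markov_Q:
  assumes "0 \<le> t" "t < s" "E \<in> sets (F (ennreal t))" "f \<in> borel_measurable borel"
  shows "(\<integral>\<^sup>+\<omega>\<in>E. f (Y s \<omega>) \<partial>law x) = (\<integral>\<^sup>+\<omega>\<in>E. (\<integral>\<^sup>+z. f z \<partial>Q (s - t) (Y t \<omega>)) \<partial>law x)"
  using markov[of t "s - t" E f x] assms by (simp add: Q_pos)

lemma occupation_measurable:
  assumes t: "0 \<le> t" and E: "E \<in> sets (F (ennreal t))" and f: "f \<in> borel_measurable borel"
  shows "(\<lambda>s. indicator {t<..} s * (\<integral>\<^sup>+\<omega>\<in>E. f (Y s \<omega>) \<partial>law x)) \<in> borel_measurable lborel"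
proof -
  interpret prob_space "law x" by (rule prob_space_Pr)
  note [measurable] = nn_integral_Q_measurable[OF f] sets_F_Pr[OF E, of "Some x"]
  have "(\<lambda>s. indicator {t<..} s * (\<integral>\<^sup>+\<omega>\<in>E. (\<integral>\<^sup>+z. f z \<partial>Q (s - t) (Y t \<omega>)) \<partial>law x)) \<in> borel_measurable lborel"
    by measurable
  also have "(\<lambda>s. indicator {t<..} s * (\<integral>\<^sup>+\<omega>\<in>E. (\<integral>\<^sup>+z. f z \<partial>Q (s - t) (Y t \<omega>)) \<partial>law x))
    = (\<lambda>s. indicator {t<..} s * (\<integral>\<^sup>+\<omega>\<in>E. f (Y s \<omega>) \<partial>law x))"
    using markov_Q[OF t _ E f, of _ x] by (auto simp: indicator_def fun_eq_iff)
  finally show ?thesis .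
qed

text \<open>
  Markov property at time \<open>t\<close> followed by Fubini and a shift of the time variable.
\<close>

lemma potential_occupation:
  assumes t: "0 \<le> t" and E: "E \<in> sets (F (ennreal t))" and f: "f \<in> borel_measurable borel"
  shows "(\<integral>\<^sup>+\<omega>\<in>E. potential P f (Y t \<omega>) \<partial>law x)
    = (\<integral>\<^sup>+s. indicator {t<..} s * (\<integral>\<^sup>+\<omega>\<in>E. f (Y s \<omega>) \<partial>law x) \<partial>lborel)"
proof -
  interpret prob_space "law x" by (rule prob_space_Pr)
  interpret pair_sigma_finite lborel "law x" ..
  note [measurable] = nn_integral_Q_measurable[OF f] sets_F_Pr[OF E, of "Some x"]
  have "(\<integral>\<^sup>+\<omega>\<in>E. potential P f (Y t \<omega>) \<partial>law x)
      = (\<integral>\<^sup>+\<omega>. \<integral>\<^sup>+s. indicator {0<..} s * (indicator E \<omega> * (\<integral>\<^sup>+z. f z \<partial>Q s (Y t \<omega>))) \<partial>lborel \<partial>law x)"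
    unfolding potential_Q
    by (subst nn_integral_multc[symmetric]) (auto simp: mult_ac)
  also have "\<dots> = (\<integral>\<^sup>+s. \<integral>\<^sup>+\<omega>. indicator {0<..} s * (indicator E \<omega> * (\<integral>\<^sup>+z. f z \<partial>Q s (Y t \<omega>))) \<partial>law x \<partial>lborel)"
    by (rule Fubini') measurable
  also have "\<dots> = (\<integral>\<^sup>+s. indicator {0<..} s * (\<integral>\<^sup>+\<omega>\<in>E. (\<integral>\<^sup>+z. f z \<partial>Q s (Y t \<omega>)) \<partial>law x) \<partial>lborel)"
    by (intro nn_integral_cong) (simp add: nn_integral_cmult mult.commute)
  also have "\<dots> = (\<integral>\<^sup>+s. indicator {0<..} (- t + 1 * s) * (\<integral>\<^sup>+\<omega>\<in>E. (\<integral>\<^sup>+z. f z \<partial>Q (- t + 1 * s) (Y t \<omega>)) \<partial>law x) \<partial>lborel)"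
    by (subst nn_integral_real_affine[where c = 1 and t = "- t"]) auto
  also have "\<dots> = (\<integral>\<^sup>+s. indicator {t<..} s * (\<integral>\<^sup>+\<omega>\<in>E. f (Y s \<omega>) \<partial>law x) \<partial>lborel)"
    using markov_Q[OF t _ E f, of _ x] by (intro nn_integral_cong) (auto simp: indicator_def)
  finally show ?thesis .
qed

subsection \<open>Hitting probabilities and potentials\<close>

text \<open>
  The first hit is taken along the grid \<open>\<tau>\<close>, \<open>\<tau> + h\<close>, \<open>\<tau> + 2h\<close>, \<open>\<dots>\<close>, which makes it a matter of
  countably many events, each belonging to the past of a constant time.
\<close>

definition first_hit :: "'a set \<Rightarrow> real \<Rightarrow> real \<Rightarrow> nat \<Rightarrow> 'w set" where
  "first_hit A \<tau> h k =
     {\<omega>\<in>\<Omega>. Y (\<tau> + real k * h) \<omega> \<in> A \<and> (\<forall>j<k. Y (\<tau> + real j * h) \<omega> \<notin> A)}"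

definition dyadic_hit :: "'a set \<Rightarrow> real \<Rightarrow> 'w set" where
  "dyadic_hit A \<tau> = {\<omega>\<in>\<Omega>. \<exists>m k. Y (\<tau> + real k * (1 / 2^m)) \<omega> \<in> A}"

definition dyadic_hit_before :: "'a set \<Rightarrow> real \<Rightarrow> real \<Rightarrow> 'w set" where
  "dyadic_hit_before A \<tau> s =
     {\<omega>\<in>\<Omega>. \<exists>m k. \<tau> + real k * (1 / 2^m) < s \<and> Y (\<tau> + real k * (1 / 2^m)) \<omega> \<in> A}"

lemma hit_sets:
  assumes "A \<in> sets borel" "s \<le> t"
  shows "{\<omega>\<in>\<Omega>. Y s \<omega> \<in> A} \<in> sets (F (ennreal t))"
  using measurable_sets[OF Y_adapted_le[OF assms(2)] assms(1)]
  by (simp add: space_F vimage_def Int_def conj_commute)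

lemma hit_sets_Pr[measurable]:
  assumes "A \<in> sets borel"
  shows "{\<omega>\<in>\<Omega>. Y s \<omega> \<in> A} \<in> sets (Pr x)"
  using hit_sets[OF assms order_refl] by (rule sets_F_Pr)

lemma first_hit_sets:
  assumes A: "A \<in> sets borel" and h: "0 < h"
  shows "first_hit A \<tau> h k \<in> sets (F (ennreal (\<tau> + real k * h)))"
proof -
  have "first_hit A \<tau> h k = {\<omega>\<in>\<Omega>. Y (\<tau> + real k * h) \<omega> \<in> A} - (\<Union>j<k. {\<omega>\<in>\<Omega>. Y (\<tau> + real j * h) \<omega> \<in> A})"
    by (auto simp: first_hit_def)
  also have "\<dots> \<in> sets (F (ennreal (\<tau> + real k * h)))"
    using h by (intro sets.Diff sets.finite_UN hit_sets[OF A]) auto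
  finally show ?thesis .
qed

lemma disjoint_first_hit: "disjoint_family (first_hit A \<tau> h)"
proof -
  have "k = j" if "\<omega> \<in> first_hit A \<tau> h k" "\<omega> \<in> first_hit A \<tau> h j" for \<omega> k j
    using that by (cases rule: linorder_cases[of k j]) (auto simp: first_hit_def)
  then show ?thesis unfolding disjoint_family_on_def by blast
qed

lemma UN_first_hit: "(\<Union>k. first_hit A \<tau> h k) = {\<omega>\<in>\<Omega>. \<exists>k. Y (\<tau> + real k * h) \<omega> \<in> A}"
proof (intro set_eqI iffI)
  fix \<omega> assume "\<omega> \<in> {\<omega>\<in>\<Omega>. \<exists>k. Y (\<tau> + real k * h) \<omega> \<in> A}"
  then have "\<omega> \<in> \<Omega>" and ex: "\<exists>k. Y (\<tau> + real k * h) \<omega> \<in> A" by auto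
  then have "\<omega> \<in> first_hit A \<tau> h (LEAST k. Y (\<tau> + real k * h) \<omega> \<in> A)"
    using LeastI_ex[OF ex] not_less_Least[of _ "\<lambda>k. Y (\<tau> + real k * h) \<omega> \<in> A"] by (simp add: first_hit_def)
  then show "\<omega> \<in> (\<Union>k. first_hit A \<tau> h k)" by blast
qed (auto simp: first_hit_def)

lemma first_hit_before:
  assumes "\<omega> \<in> first_hit A \<tau> h k" "0 < h"
  shows "(\<exists>j. \<tau> + real j * h < s \<and> Y (\<tau> + real j * h) \<omega> \<in> A) \<longleftrightarrow> \<tau> + real k * h < s"
proof
  assume "\<exists>j. \<tau> + real j * h < s \<and> Y (\<tau> + real j * h) \<omega> \<in> A"
  then obtain j where j: "\<tau> + real j * h < s" "Y (\<tau> + real j * h) \<omega> \<in> A" by auto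
  then have "k \<le> j" using assms(1) by (auto simp: first_hit_def not_less[symmetric])
  then have "real k * h \<le> real j * h" using \<open>0 < h\<close> by simp
  then show "\<tau> + real k * h < s" using j(1) by linarith
qed (use assms in \<open>auto simp: first_hit_def\<close>)

lemma grid_before_sets:
  assumes [measurable]: "A \<in> sets borel"
  shows "{\<omega>\<in>\<Omega>. \<exists>k::nat. \<tau> + real k * h < s \<and> Y (\<tau> + real k * h) \<omega> \<in> A} \<in> sets (Pr x)"
proof -
  have "{\<omega>\<in>\<Omega>. \<exists>k::nat. \<tau> + real k * h < s \<and> Y (\<tau> + real k * h) \<omega> \<in> A}
      = (\<Union>k\<in>{k::nat. \<tau> + real k * h < s}. {\<omega>\<in>\<Omega>. Y (\<tau> + real k * h) \<omega> \<in> A})"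
    by auto
  also have "\<dots> \<in> sets (Pr x)"
    by (intro sets.countable_UN'') auto
  finally show ?thesis .
qed

text \<open>
  Apply \<open>potential_occupation\<close> at each grid time, on the event that the first hit happens there.  The
  occupation times after the first hit add up to the occupation time on the event that a grid time
  before \<open>s\<close> has been a hit.
\<close>

lemma
  assumes \<tau>: "0 \<le> \<tau>" and h: "0 < h" and E: "E \<in> sets (F (ennreal \<tau>))"
    and A[measurable]: "A \<in> sets borel" and f[measurable]: "f \<in> borel_measurable borel"
  defines "S \<equiv> \<lambda>s. E \<inter> {\<omega>\<in>\<Omega>. \<exists>k. \<tau> + real k * h < s \<and> Y (\<tau> + real k * h) \<omega> \<in> A}"
  shows first_hit_occupation_measurable:
      "(\<lambda>s. \<integral>\<^sup>+\<omega>\<in>S s. f (Y s \<omega>) \<partial>law x) \<in> borel_measurable lborel" (is ?meas)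
    and first_hit_occupation:
      "(\<Sum>k. \<integral>\<^sup>+\<omega>\<in>E \<inter> first_hit A \<tau> h k. potential P f (Y (\<tau> + real k * h) \<omega>) \<partial>law x)
        = (\<integral>\<^sup>+s. (\<integral>\<^sup>+\<omega>\<in>S s. f (Y s \<omega>) \<partial>law x) \<partial>lborel)" (is ?eq)
proof -
  let ?t = "\<lambda>k. \<tau> + real k * h"
  let ?E = "\<lambda>k. E \<inter> first_hit A \<tau> h k"
  have t: "0 \<le> ?t k" "\<tau> \<le> ?t k" for k using \<tau> h by auto
  have Ek: "?E k \<in> sets (F (ennreal (?t k)))" for k
    using sets_F_le[OF E ennreal_leI[OF t(2)]] first_hit_sets[OF A h] by (rule sets.Int)
  note [measurable] = sets_F_Pr[OF Ek] sets_F_Pr[OF E]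
  have G: "(\<Sum>k. indicator {?t k<..} s * (\<integral>\<^sup>+\<omega>\<in>?E k. f (Y s \<omega>) \<partial>law x)) = (\<integral>\<^sup>+\<omega>\<in>S s. f (Y s \<omega>) \<partial>law x)" for s
  proof -
    have "(\<Sum>k. indicator {?t k<..} s * (\<integral>\<^sup>+\<omega>\<in>?E k. f (Y s \<omega>) \<partial>law x))
        = (\<Sum>k. \<integral>\<^sup>+\<omega>. indicator {?t k<..} s * (f (Y s \<omega>) * indicator (?E k) \<omega>) \<partial>law x)"
      by (subst nn_integral_cmult) auto
    also have "\<dots> = (\<integral>\<^sup>+\<omega>. (\<Sum>k. indicator {?t k<..} s * (f (Y s \<omega>) * indicator (?E k) \<omega>)) \<partial>law x)"
      by (subst nn_integral_suminf) auto
    also have "\<dots> = (\<integral>\<^sup>+\<omega>\<in>S s. f (Y s \<omega>) \<partial>law x)"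
    proof (rule nn_integral_cong)
      fix \<omega> assume "\<omega> \<in> space (law x)"
      then have \<omega>: "\<omega> \<in> \<Omega>" by simp
      show "(\<Sum>k. indicator {?t k<..} s * (f (Y s \<omega>) * indicator (?E k) \<omega>)) = f (Y s \<omega>) * indicator (S s) \<omega>"
      proof (cases "\<exists>k. \<omega> \<in> ?E k")
        case True
        then obtain k where k: "\<omega> \<in> E" "\<omega> \<in> first_hit A \<tau> h k" by auto
        have "disjoint_family ?E"
          using disjoint_first_hit[of A \<tau> h] by (auto simp: disjoint_family_on_def)
        then have "(\<Sum>k. (indicator {?t k<..} s * f (Y s \<omega>)) * indicator (?E k) \<omega>) = indicator {?t k<..} s * f (Y s \<omega>)"
          using k by (intro suminf_cmult_indicator) auto
        moreover have "\<omega> \<in> S s \<longleftrightarrow> ?t k < s"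
          using first_hit_before[OF k(2) h, of s] k \<omega> by (simp add: S_def)
        ultimately show ?thesis
          by (simp add: indicator_def mult_ac)
      next
        case False
        then have "\<omega> \<notin> S s"
          using UN_first_hit[of A \<tau> h] by (auto simp: S_def)
        then show ?thesis using False by (auto simp: indicator_def)
      qed
    qed
    finally show ?thesis .
  qed
  have meas: "(\<lambda>s. indicator {?t k<..} s * (\<integral>\<^sup>+\<omega>\<in>?E k. f (Y s \<omega>) \<partial>law x)) \<in> borel_measurable lborel" for k
    by (rule occupation_measurable[OF t(1) Ek f])
  then show ?meas
    unfolding G[symmetric] by measurable
  have "(\<Sum>k. \<integral>\<^sup>+\<omega>\<in>?E k. potential P f (Y (?t k) \<omega>) \<partial>law x)
      = (\<Sum>k. \<integral>\<^sup>+s. indicator {?t k<..} s * (\<integral>\<^sup>+\<omega>\<in>?E k. f (Y s \<omega>) \<partial>law x) \<partial>lborel)"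
    by (subst potential_occupation[OF t(1) Ek f]) simp
  also have "\<dots> = (\<integral>\<^sup>+s. (\<Sum>k. indicator {?t k<..} s * (\<integral>\<^sup>+\<omega>\<in>?E k. f (Y s \<omega>) \<partial>law x)) \<partial>lborel)"
    using meas by (rule nn_integral_suminf[symmetric])
  finally show ?eq by (simp add: G)
qed

lemma dyadic_hit_sets[measurable]:
  assumes [measurable]: "A \<in> sets borel"
  shows "dyadic_hit A \<tau> \<in> sets (Pr x)"
proof -
  have "dyadic_hit A \<tau> = (\<Union>m::nat. \<Union>k::nat. {\<omega>\<in>\<Omega>. Y (\<tau> + real k * (1 / 2^m)) \<omega> \<in> A})"
    by (auto simp: dyadic_hit_def)
  then show ?thesis by simp
qed

lemma dyadic_hit_before_F:
  assumes A: "A \<in> sets borel"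
  shows "dyadic_hit_before A \<tau> s \<in> sets (F (ennreal s))"
proof -
  have "dyadic_hit_before A \<tau> s
      = (\<Union>m::nat. \<Union>k\<in>{k::nat. \<tau> + real k * (1 / 2^m) < s}. {\<omega>\<in>\<Omega>. Y (\<tau> + real k * (1 / 2^m)) \<omega> \<in> A})"
    by (auto simp: dyadic_hit_before_def)
  also have "\<dots> \<in> sets (F (ennreal s))"
    by (intro sets.countable_UN'' hit_sets[OF A]) auto
  finally show ?thesis .
qed

lemma dyadic_hit_before_sets[measurable]:
  "A \<in> sets borel \<Longrightarrow> dyadic_hit_before A \<tau> s \<in> sets (Pr x)"
  using dyadic_hit_before_F by (rule sets_F_Pr)

lemma dyadic_hit_before_mono: "s \<le> t \<Longrightarrow> dyadic_hit_before A \<tau> s \<subseteq> dyadic_hit_before A \<tau> t"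
  unfolding dyadic_hit_before_def by force

text \<open>
  By right continuity the path stays in \<open>A\<close> for a while after \<open>s\<close>.  The hit at a dyadic distance from
  \<open>\<tau>\<close> comes strictly later than \<open>s\<close>; whence the additional \<open>t > s\<close>.
\<close>

lemma open_hit_dyadic:
  assumes A: "open A" and \<tau>: "0 \<le> \<tau>"
  shows "AE \<omega> in law x. \<forall>s\<ge>\<tau>. \<forall>t>s. Y s \<omega> \<in> A \<longrightarrow> \<omega> \<in> dyadic_hit_before A \<tau> t"
  using Y_right_continuous[of x]
proof (rule AE_mp, intro AE_I2 impI allI)
  fix \<omega> s t
  assume \<omega>: "\<omega> \<in> space (law x)" "\<forall>t\<ge>0. ((\<lambda>s. Y s \<omega>) \<longlongrightarrow> Y t \<omega>) (at_right t)"
    and s: "\<tau> \<le> s" "s < t" "Y s \<omega> \<in> A"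
  have "((\<lambda>u. Y u \<omega>) \<longlongrightarrow> Y s \<omega>) (at_right s)"
    using \<omega>(2) s(1) \<tau> by simp
  then have "\<forall>\<^sub>F u in at_right s. Y u \<omega> \<in> A"
    using A s(3) by (rule topological_tendstoD)
  moreover have "\<forall>\<^sub>F u in at_right s. u < t"
    using s(2) by (auto simp: eventually_at_right_field)
  ultimately have "\<forall>\<^sub>F u in at_right s. Y u \<omega> \<in> A \<and> u < t"
    by (rule eventually_conj)
  moreover have "filterlim (\<lambda>m. \<tau> + dyadic_above m (s - \<tau>)) (at_right s) sequentially"
  proof -
    have "(\<lambda>m. \<tau> + dyadic_above m (s - \<tau>)) \<longlonglongrightarrow> \<tau> + (s - \<tau>)"
      using dyadic_above_tendsto[of "s - \<tau>"] by (intro tendsto_intros) (simp add: filterlim_at)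
    moreover have "s < \<tau> + dyadic_above m (s - \<tau>)" for m
      using dyadic_above_bounds(1)[of "s - \<tau>" m] by linarith
    ultimately show ?thesis
      by (auto simp: filterlim_at intro!: always_eventually less_imp_neq[symmetric])
  qed
  ultimately have "\<forall>\<^sub>F m in sequentially. Y (\<tau> + dyadic_above m (s - \<tau>)) \<omega> \<in> A \<and> \<tau> + dyadic_above m (s - \<tau>) < t"
    by (rule eventually_compose_filterlim)
  then obtain m where m: "Y (\<tau> + dyadic_above m (s - \<tau>)) \<omega> \<in> A" "\<tau> + dyadic_above m (s - \<tau>) < t"
    by (auto simp: eventually_sequentially)
  have "dyadic_above m (s - \<tau>) = real (nat (\<lfloor>(s - \<tau>) * 2^m\<rfloor> + 1)) * (1 / 2^m)"
    using s by (simp add: dyadic_above_def of_nat_nat)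
  then show "\<omega> \<in> dyadic_hit_before A \<tau> t"
    using m \<omega>(1) unfolding dyadic_hit_before_def by auto
qed

text \<open>
  A path that is in \<open>A\<close> at time \<open>s\<close> without an earlier dyadic hit makes the probability \<open>\<beta>(s)\<close> of a
  dyadic hit before \<open>s\<close> jump at \<open>s\<close>.  A monotone function has at most countably many jumps.  In
  terms of the hitting time: its distribution has at most countably many atoms.
\<close>

lemma AE_hit_dyadic_before:
  assumes A: "open A" and \<tau>: "0 \<le> \<tau>"
  shows "AE s in lborel. \<tau> < s \<longrightarrow> (AE \<omega> in law x. Y s \<omega> \<in> A \<longrightarrow> \<omega> \<in> dyadic_hit_before A \<tau> s)"
proof -
  interpret prob_space "law x" by (rule prob_space_Pr)
  have [measurable]: "A \<in> sets borel" using A by simp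
  define \<beta> where "\<beta> s = prob (dyadic_hit_before A \<tau> s)" for s
  have "mono \<beta>"
    unfolding \<beta>_def by (intro monoI finite_measure_mono dyadic_hit_before_mono) auto
  then have "{s. \<not> isCont \<beta> s} \<in> null_sets lborel"
    by (intro countable_imp_null_set_lborel mono_ctble_discont)
  then have "AE s in lborel. isCont \<beta> s"
    using AE_not_in by fastforce
  then show ?thesis
  proof (rule eventually_mono, intro impI)
    fix s assume cont: "isCont \<beta> s" and s: "\<tau> < s"
    define D where "D = {\<omega>\<in>\<Omega>. Y s \<omega> \<in> A} - dyadic_hit_before A \<tau> s"
    have [measurable]: "D \<in> sets (law x)" unfolding D_def by measurable
    have "prob D \<le> \<beta> t - \<beta> s" if "s < t" for t
    proof -
      have "prob D \<le> prob (dyadic_hit_before A \<tau> t - dyadic_hit_before A \<tau> s)"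
      proof (rule finite_measure_mono_AE)
        show "AE \<omega> in law x. \<omega> \<in> D \<longrightarrow> \<omega> \<in> dyadic_hit_before A \<tau> t - dyadic_hit_before A \<tau> s"
          using open_hit_dyadic[OF A \<tau>, of x]
        proof (rule eventually_mono)
          fix \<omega> assume "\<forall>s\<ge>\<tau>. \<forall>t>s. Y s \<omega> \<in> A \<longrightarrow> \<omega> \<in> dyadic_hit_before A \<tau> t"
          then have "Y s \<omega> \<in> A \<longrightarrow> \<omega> \<in> dyadic_hit_before A \<tau> t"
            using less_imp_le[OF s] that by blast
          then show "\<omega> \<in> D \<longrightarrow> \<omega> \<in> dyadic_hit_before A \<tau> t - dyadic_hit_before A \<tau> s"
            by (auto simp: D_def)
        qed
      qed measurable
      also have "\<dots> = \<beta> t - \<beta> s"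
        using dyadic_hit_before_mono[of s t A \<tau>] that
        by (simp add: \<beta>_def finite_measure_Diff)
      finally show ?thesis .
    qed
    then have "\<forall>\<^sub>F t in at_right s. prob D \<le> \<beta> t - \<beta> s"
      by (auto simp: eventually_at_right_field intro: exI[of _ "s + 1"])
    moreover have "((\<lambda>t. \<beta> t - \<beta> s) \<longlongrightarrow> \<beta> s - \<beta> s) (at_right s)"
      using cont by (intro tendsto_intros) (auto simp: isCont_def intro: filterlim_mono at_le)
    ultimately have "prob D \<le> \<beta> s - \<beta> s"
      by (intro tendsto_lowerbound) auto
    then have "prob D = 0" by (simp add: measure_le_0_iff)
    then have "AE \<omega> in law x. \<omega> \<notin> D"
      by (intro AE_not_in) (auto simp: emeasure_eq_measure null_sets_def)
    then show "AE \<omega> in law x. Y s \<omega> \<in> A \<longrightarrow> \<omega> \<in> dyadic_hit_before A \<tau> s"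
      by (rule AE_mp) (auto simp: D_def intro!: AE_I2)
  qed
qed

text \<open>
  Since \<open>f\<close> vanishes off \<open>A\<close>, it is only charged after \<open>A\<close> has been hit.  Along a grid, the
  occupation after the first hit is the mean of the potential at the first hit, so at most \<open>M\<close> times
  the probability of a hit.  Refining the grid exhausts the occupation after the hitting time.
\<close>

lemma potential_le_hit:
  assumes \<tau>: "0 \<le> \<tau>" and E: "E \<in> sets (F (ennreal \<tau>))" and A: "open A"
    and f[measurable]: "f \<in> borel_measurable borel" and off: "\<And>y. y \<notin> A \<Longrightarrow> f y = 0"
    and le: "\<And>y. potential P f y \<le> M"
  shows "(\<integral>\<^sup>+\<omega>\<in>E. potential P f (Y \<tau> \<omega>) \<partial>law x) \<le> M * emeasure (law x) (E \<inter> dyadic_hit A \<tau>)"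
proof -
  have A'[measurable]: "A \<in> sets borel" using A by simp
  note [measurable] = sets_F_Pr[OF E, of "Some x"]
  define S where "S m s = E \<inter> {\<omega>\<in>\<Omega>. \<exists>k. \<tau> + real k * (1 / 2^m) < s \<and> Y (\<tau> + real k * (1 / 2^m)) \<omega> \<in> A}" for m :: nat and s
  define G where "G m s = (\<integral>\<^sup>+\<omega>\<in>S m s. f (Y s \<omega>) \<partial>law x)" for m s
  have [measurable]: "S m s \<in> sets (law x)" for m s
    unfolding S_def using sets_F_Pr[OF E] grid_before_sets[OF A'] by (rule sets.Int)
  have G_meas[measurable]: "G m \<in> borel_measurable lborel" for m
    unfolding G_def[abs_def] S_def by (rule first_hit_occupation_measurable[OF \<tau> _ E A' f]) simp
  have S_mono: "incseq (\<lambda>m. S m s)" for s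
  proof (rule incseq_SucI, rule subsetI)
    fix m \<omega> assume "\<omega> \<in> S m s"
    then obtain k where k: "\<omega> \<in> E" "\<omega> \<in> \<Omega>" "\<tau> + real k * (1 / 2^m) < s" "Y (\<tau> + real k * (1 / 2^m)) \<omega> \<in> A"
      by (auto simp: S_def)
    moreover have "real (2 * k) * (1 / 2 ^ Suc m) = real k * (1 / 2^m)" by simp
    ultimately have "\<tau> + real (2 * k) * (1 / 2 ^ Suc m) < s \<and> Y (\<tau> + real (2 * k) * (1 / 2 ^ Suc m)) \<omega> \<in> A"
      by (simp only:)
    then show "\<omega> \<in> S (Suc m) s"
      unfolding S_def using k(1,2) by blast
  qed
  have G_mono: "incseq G"
    unfolding G_def incseq_def le_fun_def
    using S_mono by (intro allI impI nn_integral_mono mult_left_mono)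
      (auto simp: incseq_def indicator_def subset_iff)
  have G_le: "(\<integral>\<^sup>+s. G m s \<partial>lborel) \<le> M * emeasure (law x) (E \<inter> dyadic_hit A \<tau>)" for m
  proof -
    let ?h = "1 / 2^m :: real"
    let ?E = "\<lambda>k. E \<inter> first_hit A \<tau> ?h k"
    have [measurable]: "first_hit A \<tau> ?h k \<in> sets (law x)" for k
      using sets_F_Pr[OF first_hit_sets[OF A', of ?h]] by simp
    have disj: "disjoint_family ?E"
      using disjoint_first_hit[of A \<tau> ?h] by (auto simp: disjoint_family_on_def)
    have "(\<integral>\<^sup>+s. G m s \<partial>lborel)
        = (\<Sum>k. \<integral>\<^sup>+\<omega>\<in>?E k. potential P f (Y (\<tau> + real k * ?h) \<omega>) \<partial>law x)"
      unfolding G_def S_def by (rule first_hit_occupation[OF \<tau> _ E A' f, symmetric]) simp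
    also have "\<dots> \<le> (\<Sum>k. \<integral>\<^sup>+\<omega>\<in>?E k. M \<partial>law x)"
      using le by (intro suminf_le nn_integral_mono mult_right_mono) auto
    also have "\<dots> = M * (\<Sum>k. emeasure (law x) (?E k))"
      by (simp add: nn_integral_cmult_indicator)
    also have "\<dots> = M * emeasure (law x) (\<Union>k. ?E k)"
      using disj by (subst suminf_emeasure) auto
    also have "\<dots> \<le> M * emeasure (law x) (E \<inter> dyadic_hit A \<tau>)"
    proof (intro mult_left_mono emeasure_mono)
      show "(\<Union>k. ?E k) \<subseteq> E \<inter> dyadic_hit A \<tau>"
        by (auto simp: first_hit_def dyadic_hit_def)
      show "E \<inter> dyadic_hit A \<tau> \<in> sets (law x)"
        using sets_F_Pr[OF E] dyadic_hit_sets[OF A'] by (rule sets.Int)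
    qed simp
    finally show ?thesis .
  qed
  have "AE s in lborel. indicator {\<tau><..} s * (\<integral>\<^sup>+\<omega>\<in>E. f (Y s \<omega>) \<partial>law x) \<le> (SUP m. G m s)"
    using AE_hit_dyadic_before[OF A \<tau>, of x]
  proof (rule eventually_mono)
    fix s assume *: "\<tau> < s \<longrightarrow> (AE \<omega> in law x. Y s \<omega> \<in> A \<longrightarrow> \<omega> \<in> dyadic_hit_before A \<tau> s)"
    show "indicator {\<tau><..} s * (\<integral>\<^sup>+\<omega>\<in>E. f (Y s \<omega>) \<partial>law x) \<le> (SUP m. G m s)"
    proof (cases "\<tau> < s")
      case True
      have "(\<integral>\<^sup>+\<omega>\<in>E. f (Y s \<omega>) \<partial>law x) \<le> (\<integral>\<^sup>+\<omega>. (SUP m. f (Y s \<omega>) * indicator (S m s) \<omega>) \<partial>law x)"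
      proof (rule nn_integral_mono_AE)
        have "AE \<omega> in law x. Y s \<omega> \<in> A \<longrightarrow> \<omega> \<in> dyadic_hit_before A \<tau> s" using * True by simp
        then show "AE \<omega> in law x. f (Y s \<omega>) * indicator E \<omega> \<le> (SUP m. f (Y s \<omega>) * indicator (S m s) \<omega>)"
        proof (rule eventually_mono)
          fix \<omega> assume hit: "Y s \<omega> \<in> A \<longrightarrow> \<omega> \<in> dyadic_hit_before A \<tau> s"
          show "f (Y s \<omega>) * indicator E \<omega> \<le> (SUP m. f (Y s \<omega>) * indicator (S m s) \<omega>)"
          proof (cases "Y s \<omega> \<in> A \<and> \<omega> \<in> E")
            case True
            then obtain m where "\<omega> \<in> S m s"
              using hit by (auto simp: dyadic_hit_before_def S_def)
            then show ?thesis using True by (intro SUP_upper2[of m]) auto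
          next
            case False
            then show ?thesis using off[of "Y s \<omega>"] by (auto simp: indicator_def)
          qed
        qed
      qed
      also have "\<dots> = (SUP m. \<integral>\<^sup>+\<omega>. f (Y s \<omega>) * indicator (S m s) \<omega> \<partial>law x)"
        using S_mono[of s]
        by (intro nn_integral_monotone_convergence_SUP)
          (auto simp: incseq_def le_fun_def indicator_def subset_iff intro!: mult_left_mono)
      finally show ?thesis using True by (simp add: G_def)
    qed simp
  qed
  then have "(\<integral>\<^sup>+s. indicator {\<tau><..} s * (\<integral>\<^sup>+\<omega>\<in>E. f (Y s \<omega>) \<partial>law x) \<partial>lborel) \<le> (\<integral>\<^sup>+s. (SUP m. G m s) \<partial>lborel)"
    by (rule nn_integral_mono_AE)
  also have "\<dots> = (SUP m. \<integral>\<^sup>+s. G m s \<partial>lborel)"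
    using G_mono G_meas by (intro nn_integral_monotone_convergence_SUP) auto
  also have "\<dots> \<le> M * emeasure (law x) (E \<inter> dyadic_hit A \<tau>)"
    using G_le by (intro SUP_least)
  finally show ?thesis
    by (simp add: potential_occupation[OF \<tau> E f])
qed

text \<open>
  The converse comparison: at the first hit along a grid the potential is at least \<open>1\<close>, and the
  occupation after that hit is part of the whole occupation.
\<close>

lemma hit_le_potential:
  assumes A[measurable]: "A \<in> sets borel" and f[measurable]: "f \<in> borel_measurable borel"
    and ge: "\<And>y. y \<in> A \<Longrightarrow> 1 \<le> potential P f y"
  shows "emeasure (law x) (dyadic_hit A 0) \<le> potential P f x"
proof -
  define H where "H m = {\<omega>\<in>\<Omega>. \<exists>k. Y (0 + real k * (1 / 2^m)) \<omega> \<in> A}" for m :: nat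
  have H_eq: "H m = (\<Union>k. first_hit A 0 (1 / 2^m) k)" for m
    unfolding H_def UN_first_hit ..
  have fh[measurable]: "first_hit A 0 (1 / 2^m) k \<in> sets (law x)" for k and m :: nat
    using sets_F_Pr[OF first_hit_sets[OF A, of "1 / 2^m"]] by simp
  have [measurable]: "H m \<in> sets (law x)" for m
    unfolding H_eq by simp
  have H_mono: "incseq H"
  proof (rule incseq_SucI, rule subsetI)
    fix m \<omega> assume "\<omega> \<in> H m"
    then obtain k where k: "\<omega> \<in> \<Omega>" "Y (0 + real k * (1 / 2^m)) \<omega> \<in> A"
      by (auto simp: H_def)
    moreover have "real (2 * k) * (1 / 2 ^ Suc m) = real k * (1 / 2^m)" by simp
    ultimately have "Y (0 + real (2 * k) * (1 / 2 ^ Suc m)) \<omega> \<in> A"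
      by (simp only:)
    then show "\<omega> \<in> H (Suc m)"
      unfolding H_def using k(1) by blast
  qed
  have "emeasure (law x) (H m) \<le> potential P f x" for m
  proof -
    let ?h = "1 / 2^m :: real"
    have \<Omega>: "\<Omega> \<in> sets (F (ennreal 0))" using sets.top[of "F (ennreal 0)"] by (simp add: space_F)
    have "emeasure (law x) (H m) = (\<Sum>k. emeasure (law x) (first_hit A 0 ?h k))"
      using disjoint_first_hit unfolding H_eq by (subst suminf_emeasure) auto
    also have "\<dots> = (\<Sum>k. \<integral>\<^sup>+\<omega>\<in>\<Omega> \<inter> first_hit A 0 ?h k. 1 \<partial>law x)"
    proof (rule suminf_cong)
      fix k
      have "first_hit A 0 ?h k = \<Omega> \<inter> first_hit A 0 ?h k" by (auto simp: first_hit_def)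
      then show "emeasure (law x) (first_hit A 0 ?h k) = (\<integral>\<^sup>+\<omega>\<in>\<Omega> \<inter> first_hit A 0 ?h k. 1 \<partial>law x)"
        by simp
    qed
    also have "\<dots> \<le> (\<Sum>k. \<integral>\<^sup>+\<omega>\<in>\<Omega> \<inter> first_hit A 0 ?h k. potential P f (Y (0 + real k * ?h) \<omega>) \<partial>law x)"
      using ge by (intro suminf_le nn_integral_mono) (auto simp: first_hit_def indicator_def)
    also have "\<dots> = (\<integral>\<^sup>+s. (\<integral>\<^sup>+\<omega>\<in>\<Omega> \<inter> {\<omega>\<in>\<Omega>. \<exists>k. 0 + real k * ?h < s \<and> Y (0 + real k * ?h) \<omega> \<in> A}. f (Y s \<omega>) \<partial>law x) \<partial>lborel)"
      by (rule first_hit_occupation[OF _ _ \<Omega> A f]) auto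
    also have "\<dots> \<le> (\<integral>\<^sup>+s\<in>{0<..}. (\<integral>\<^sup>+z. f z \<partial>Q s x) \<partial>lborel)"
    proof (rule nn_integral_mono)
      fix s
      show "(\<integral>\<^sup>+\<omega>\<in>\<Omega> \<inter> {\<omega>\<in>\<Omega>. \<exists>k. 0 + real k * ?h < s \<and> Y (0 + real k * ?h) \<omega> \<in> A}. f (Y s \<omega>) \<partial>law x)
        \<le> (\<integral>\<^sup>+z. f z \<partial>Q s x) * indicator {0<..} s"
      proof (cases "0 < s")
        case True
        then show ?thesis
          by (auto simp: nn_integral_Q max_def indicator_def intro!: nn_integral_mono)
      next
        case False
        then have "\<not> 0 + real k * ?h < s" for k
          by (auto simp: not_less intro: order_trans[of s 0])
        then show ?thesis by simp
      qed
    qed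
    finally show ?thesis by (simp add: potential_Q)
  qed
  then have "(SUP m. emeasure (law x) (H m)) \<le> potential P f x"
    by (intro SUP_least)
  moreover have "(\<Union>m. H m) = dyadic_hit A 0"
    by (auto simp: H_def dyadic_hit_def)
  moreover have "range H \<subseteq> sets (law x)" by auto
  ultimately show ?thesis
    using SUP_emeasure_incseq[of H "law x"] H_mono by simp
qed

subsection \<open>Criteria for being unavoidable\<close>

lemma space_in_F: "\<Omega> \<in> sets (F t)"
  using sets.top[of "F t"] by (simp add: space_F)

text \<open>
  Given that there is no hit before time \<open>n\<close>, Fatou's lemma and \<open>potential_le_hit\<close> bound the
  probability of a hit after time \<open>n\<close> from below by \<open>\<delta>\<close>.  The probability that the first hit comes
  after \<open>n\<close> tends to \<open>0\<close>, hence so does the probability of no hit before \<open>n\<close>.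
\<close>

lemma hits_almost_surely:
  assumes A: "open A"
    and f: "\<And>n. f n \<in> borel_measurable borel" and off: "\<And>n y. y \<notin> A \<Longrightarrow> f n y = 0"
    and le: "\<And>n y. potential P (f n) y \<le> 1"
    and \<delta>: "0 < \<delta>" and ev: "\<And>y. \<forall>\<^sub>F n in sequentially. ennreal \<delta> \<le> potential P (f n) y"
  shows "AE \<omega> in law x. \<omega> \<in> dyadic_hit A 0"
proof -
  interpret prob_space "law x" by (rule prob_space_Pr)
  have A'[measurable]: "A \<in> sets borel" using A by simp
  let ?N = "dyadic_hit A 0" and ?B = "\<lambda>n::nat. dyadic_hit_before A 0 (real n)"
  have key: "\<delta> * (1 - prob ?N) \<le> prob ?N - prob (?B n)" for n
  proof -
    define E where "E = \<Omega> - ?B n"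
    have E: "E \<in> sets (F (ennreal (real n)))"
      unfolding E_def by (intro sets.Diff space_in_F dyadic_hit_before_F A')
    note [measurable] = sets_F_Pr[OF E, of "Some x"] potential_measurable[OF f]
    have BN: "?B n \<subseteq> ?N"
      by (auto simp: dyadic_hit_before_def dyadic_hit_def)
    \<comment> \<open>A dyadic distance from the integer \<open>n\<close> is a dyadic distance from \<open>0\<close>.\<close>
  have later: "dyadic_hit A (real n) \<subseteq> ?N"
    proof
      fix \<omega> assume "\<omega> \<in> dyadic_hit A (real n)"
      then obtain m k where "\<omega> \<in> \<Omega>" "Y (real n + real k * (1 / 2^m)) \<omega> \<in> A"
        by (auto simp: dyadic_hit_def)
      moreover have "real n + real k * (1 / 2^m) = 0 + real (n * 2^m + k) * (1 / 2^m)"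
        by (simp add: field_simps)
      ultimately show "\<omega> \<in> ?N"
        unfolding dyadic_hit_def by (metis (mono_tags, lifting) mem_Collect_eq)
    qed
    have "ennreal \<delta> * emeasure (law x) E = (\<integral>\<^sup>+\<omega>\<in>E. ennreal \<delta> \<partial>law x)"
      by (simp add: nn_integral_cmult_indicator)
    also have "\<dots> \<le> (\<integral>\<^sup>+\<omega>. liminf (\<lambda>j. potential P (f j) (Y n \<omega>) * indicator E \<omega>) \<partial>law x)"
      using ev by (intro nn_integral_mono Liminf_bounded) (auto simp: indicator_def)
    also have "\<dots> \<le> liminf (\<lambda>j. \<integral>\<^sup>+\<omega>\<in>E. potential P (f j) (Y n \<omega>) \<partial>law x)"
      by (rule nn_integral_liminf) measurable
    also have "\<dots> \<le> liminf (\<lambda>j. emeasure (law x) (E \<inter> dyadic_hit A n))"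
      using potential_le_hit[OF _ E A f off le, of x]
      by (intro Liminf_mono always_eventually allI) simp
    also have "\<dots> = emeasure (law x) (E \<inter> dyadic_hit A n)"
      by (simp add: Liminf_const)
    finally have "\<delta> * prob E \<le> prob (E \<inter> dyadic_hit A n)"
      using \<delta> by (simp add: emeasure_eq_measure ennreal_mult''[symmetric])
    also have "\<dots> \<le> prob (?N - ?B n)"
      using later by (intro finite_measure_mono) (auto simp: E_def)
    also have "\<dots> = prob ?N - prob (?B n)"
      using BN by (intro finite_measure_Diff) auto
    finally have upper: "\<delta> * prob E \<le> prob ?N - prob (?B n)" .
    have "prob E = 1 - prob (?B n)"
      unfolding E_def using prob_compl[of "?B n"] by simp
    moreover have "prob (?B n) \<le> prob ?N"
      using BN by (intro finite_measure_mono) auto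
    ultimately have "\<delta> * (1 - prob ?N) \<le> \<delta> * prob E"
      using \<delta> by (intro mult_left_mono) auto
    then show ?thesis using upper by (rule order_trans)
  qed
  have "(\<lambda>n. prob (?B n)) \<longlonglongrightarrow> prob (\<Union>n. ?B n)"
    by (intro finite_Lim_measure_incseq) (auto simp: incseq_def intro!: dyadic_hit_before_mono)
  also have "(\<Union>n. ?B n) = ?N"
  proof (intro set_eqI iffI)
    fix \<omega> assume "\<omega> \<in> ?N"
    then obtain m k where mk: "\<omega> \<in> \<Omega>" "Y (0 + real k * (1 / 2^m)) \<omega> \<in> A"
      by (auto simp: dyadic_hit_def)
    obtain n :: nat where "0 + real k * (1 / 2^m) < real n" using reals_Archimedean2 by blast
    then show "\<omega> \<in> (\<Union>n. ?B n)"
      using mk unfolding dyadic_hit_before_def by blast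
  qed (auto simp: dyadic_hit_before_def dyadic_hit_def)
  finally have "(\<lambda>n. prob ?N - prob (?B n)) \<longlonglongrightarrow> prob ?N - prob ?N"
    by (intro tendsto_intros)
  then have "\<delta> * (1 - prob ?N) \<le> prob ?N - prob ?N"
    using key by (intro LIMSEQ_le_const) auto
  then have "1 \<le> prob ?N"
    using \<delta> by (simp add: mult_le_0_iff)
  then have "prob ?N = 1"
    using prob_le_1[of ?N] by linarith
  then show ?thesis by (subst (asm) prob_eq_1) auto
qed

text \<open>
  The events \<open>dyadic_hit\<close> are measurable, whereas the event that the hitting time is finite is so
  only in the completion.
\<close>

lemma AE_hitting_time_iff:
  assumes A: "open A"
  shows "AE \<omega> in law x. hitting_time X A \<omega> < \<infinity> \<longleftrightarrow> \<omega> \<in> dyadic_hit A 0"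
  using AE_space alive open_hit_dyadic[OF A order_refl, of x]
proof eventually_elim
  fix \<omega> assume \<omega>: "\<omega> \<in> space (law x)" and alive: "\<forall>t\<ge>0. X (ennreal t) \<omega> = Some (Y t \<omega>)"
    and hit: "\<forall>s\<ge>0. \<forall>t>s. Y s \<omega> \<in> A \<longrightarrow> \<omega> \<in> dyadic_hit_before A 0 t"
  have "hitting_time X A \<omega> < \<infinity> \<longleftrightarrow> (\<exists>t<\<infinity>. X t \<omega> \<in> Some ` A)"
    unfolding hitting_time_def by (auto simp: Inf_less_iff)
  also have "\<dots> \<longleftrightarrow> (\<exists>s\<ge>0. Y s \<omega> \<in> A)"
  proof
    assume "\<exists>t<\<infinity>. X t \<omega> \<in> Some ` A"
    then obtain t where t: "t < \<infinity>" "X t \<omega> \<in> Some ` A" by blast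
    then obtain s where "0 \<le> s" "t = ennreal s" by (cases t) auto
    then show "\<exists>s\<ge>0. Y s \<omega> \<in> A" using t alive by auto
  next
    assume "\<exists>s\<ge>0. Y s \<omega> \<in> A"
    then obtain s where "0 \<le> s" "Y s \<omega> \<in> A" by blast
    then show "\<exists>t<\<infinity>. X t \<omega> \<in> Some ` A"
      using alive by (intro exI[of _ "ennreal s"]) auto
  qed
  also have "\<dots> \<longleftrightarrow> \<omega> \<in> dyadic_hit A 0"
  proof
    assume "\<exists>s\<ge>0. Y s \<omega> \<in> A"
    then obtain s where "0 \<le> s" "Y s \<omega> \<in> A" by blast
    then have "\<omega> \<in> dyadic_hit_before A 0 (s + 1)" using hit by auto
    then show "\<omega> \<in> dyadic_hit A 0" by (auto simp: dyadic_hit_before_def dyadic_hit_def)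
  next
    assume "\<omega> \<in> dyadic_hit A 0"
    then obtain m k where "Y (0 + real k * (1 / 2^m)) \<omega> \<in> A" by (auto simp: dyadic_hit_def)
    then show "\<exists>s\<ge>0. Y s \<omega> \<in> A" by (intro exI[of _ "0 + real k * (1 / 2^m)"]) auto
  qed
  finally show "hitting_time X A \<omega> < \<infinity> \<longleftrightarrow> \<omega> \<in> dyadic_hit A 0" .
qed

lemma unavoidable_iff_dyadic:
  assumes "open A"
  shows "unavoidable X Pr A \<longleftrightarrow> (\<forall>x. AE \<omega> in law x. \<omega> \<in> dyadic_hit A 0)"
proof -
  have "(AE \<omega> in law x. hitting_time X A \<omega> < \<infinity>) \<longleftrightarrow> (AE \<omega> in law x. \<omega> \<in> dyadic_hit A 0)" for x
    using AE_hitting_time_iff[OF assms, of x] by (intro eventually_subst) 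
  then show ?thesis by (simp add: unavoidable_def)
qed

text \<open>
  If the potential were at least \<open>1\<close> everywhere, its mean at time \<open>n\<close> would be at least \<open>1\<close>.  But this
  mean is the tail of the convergent integral that defines the potential at \<open>x\<close>.
\<close>

lemma exists_potential_less_1:
  assumes f[measurable]: "f \<in> borel_measurable borel" and fin: "potential P f x < \<infinity>"
  shows "\<exists>y. potential P f y < 1"
proof (rule ccontr)
  assume "\<not> ?thesis"
  then have ge: "1 \<le> potential P f y" for y by (simp add: not_less)
  interpret prob_space "law x" by (rule prob_space_Pr)
  define h where "h s = indicator {0<..} s * (\<integral>\<^sup>+\<omega>\<in>\<Omega>. f (Y s \<omega>) \<partial>law x)" for s
  have [measurable]: "h \<in> borel_measurable lborel"
    unfolding h_def[abs_def] by (rule occupation_measurable[OF _ space_in_F f]) simp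
  let ?D = "density lborel h"
  have "(\<integral>\<^sup>+s. h s \<partial>lborel) = (\<integral>\<^sup>+s\<in>{0<..}. (\<integral>\<^sup>+z. f z \<partial>Q s x) \<partial>lborel)"
    by (intro nn_integral_cong)
      (auto simp: h_def nn_integral_Q max_def indicator_def intro!: nn_integral_cong)
  then have h_fin: "(\<integral>\<^sup>+s. h s \<partial>lborel) < \<infinity>"
    using fin by (simp add: potential_Q)
  have "1 \<le> emeasure ?D {real n<..}" for n
  proof -
    have "1 = emeasure (law x) \<Omega>" using emeasure_space_1 by simp
    also have "\<dots> = (\<integral>\<^sup>+\<omega>\<in>\<Omega>. 1 \<partial>law x)"
      using sets.top[of "law x"] by simp
    also have "\<dots> \<le> (\<integral>\<^sup>+\<omega>\<in>\<Omega>. potential P f (Y n \<omega>) \<partial>law x)"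
      using ge by (intro nn_integral_mono mult_right_mono) auto
    also have "\<dots> = (\<integral>\<^sup>+s. indicator {real n<..} s * (\<integral>\<^sup>+\<omega>\<in>\<Omega>. f (Y s \<omega>) \<partial>law x) \<partial>lborel)"
      by (rule potential_occupation[OF _ space_in_F f]) simp
    also have "\<dots> = (\<integral>\<^sup>+s. h s * indicator {real n<..} s \<partial>lborel)"
      by (intro nn_integral_cong) (auto simp: h_def indicator_def)
    also have "\<dots> = emeasure ?D {real n<..}"
      by (subst emeasure_density) auto
    finally show ?thesis .
  qed
  moreover have "(\<lambda>n. emeasure ?D {real n<..}) \<longlonglongrightarrow> emeasure ?D (\<Inter>n. {real n<..})"
  proof (rule Lim_emeasure_decseq)
    show "emeasure ?D {real n<..} \<noteq> \<infinity>" for n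
    proof -
      have "emeasure ?D {real n<..} \<le> (\<integral>\<^sup>+s. h s \<partial>lborel)"
        by (subst emeasure_density) (auto intro!: nn_integral_mono simp: indicator_def)
      then show ?thesis using h_fin by auto
    qed
  qed (auto simp: decseq_def)
  ultimately have "1 \<le> emeasure ?D (\<Inter>n. {real n<..})"
    by (intro LIMSEQ_le_const) auto
  moreover have "(\<Inter>n. {real n<..}) = {}"
  proof -
    have "\<exists>n. \<not> real n < u" for u using real_arch_simple[of u] by (auto simp: not_less)
    then show ?thesis by auto
  qed
  ultimately show False by simp
qed

end

section \<open>Potentials of balls under a radial Green function\<close>

text \<open>
  The parameters \<open>d\<close>, \<open>\<omega>\<close>, \<open>K\<close> abbreviate the dimension, the volume of the unit ball, and the constant
  in the upper bounds for potentials of balls.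
\<close>

locale radial_green =
  fixes G :: "'a::euclidean_space \<Rightarrow> ennreal" and g :: "real \<Rightarrow> ennreal" and R\<^sub>0 C :: real
    and d :: nat and \<omega> K :: real
  assumes d_eq: "d = DIM('a)" and \<omega>_eq: "\<omega> = unit_ball_vol (real DIM('a))" and K_eq: "K = C * 3 ^ d"
    and G_eq: "\<And>x. G x = g (norm x)"
    and G_measurable[measurable]: "G \<in> borel_measurable borel"
    and g_antimono: "antimono_on {0..} g"
    and g_pos_finite: "\<And>s. s > 0 \<Longrightarrow> 0 < g s \<and> g s < \<infinity>"
    and R0: "0 \<le> R\<^sub>0" and C: "1 \<le> C"
    and LD: "\<And>r. r > R\<^sub>0 \<Longrightarrow> of_nat DIM('a) * (\<integral>\<^sup>+s\<in>{0<..<r}. ennreal (s ^ (DIM('a) - 1)) * g s \<partial>lborel)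
          \<le> ennreal (C * r ^ DIM('a)) * g r"
begin

definition \<gamma> :: "real \<Rightarrow> real" where "\<gamma> s = enn2real (g s)"

definition ball_potential :: "'a \<Rightarrow> 'a \<Rightarrow> real \<Rightarrow> ennreal" where
  "ball_potential y z r = (\<integral>\<^sup>+x. G (y - x) * indicator (ball z r) x \<partial>lborel)"

lemma \<omega>_pos: "0 < \<omega>"
  unfolding \<omega>_eq by (rule unit_ball_vol_pos) simp

lemma emeasure_ball_\<omega>: "0 \<le> r \<Longrightarrow> emeasure lborel (ball (c::'a) r) = ennreal (\<omega> * r ^ d)"
  by (simp add: emeasure_ball \<omega>_eq d_eq)

lemma g_eq: "s > 0 \<Longrightarrow> g s = ennreal (\<gamma> s)"
  using g_pos_finite[of s] by (simp add: \<gamma>_def)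

lemma \<gamma>_pos: "s > 0 \<Longrightarrow> 0 < \<gamma> s"
  using g_pos_finite[of s] by (simp add: \<gamma>_def enn2real_positive_iff)

lemma \<gamma>_nonneg[simp]: "0 \<le> \<gamma> s"
  by (simp add: \<gamma>_def)

lemma nn_integral_const_ball:
  assumes "0 \<le> r" "0 \<le> t"
  shows "(\<integral>\<^sup>+x. ennreal t * indicator (ball (c::'a) r) x \<partial>lborel) = ennreal (\<omega> * r ^ d * t)"
proof -
  have "(\<integral>\<^sup>+x. ennreal t * indicator (ball (c::'a) r) x \<partial>lborel) = ennreal t * ennreal (\<omega> * r ^ d)"
    using assms by (subst nn_integral_cmult_indicator) (auto simp: emeasure_ball_\<omega>)
  then show ?thesis
    using assms \<omega>_pos by (simp add: ennreal_mult[symmetric] mult_ac)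
qed

lemma g_mono: "0 \<le> s \<Longrightarrow> s \<le> t \<Longrightarrow> g t \<le> g s"
  using monotone_onD[OF g_antimono, of s t] by simp

lemma \<gamma>_mono: "0 < s \<Longrightarrow> s \<le> t \<Longrightarrow> \<gamma> t \<le> \<gamma> s"
  using g_mono[of s t] g_eq[of s] g_eq[of t] \<gamma>_pos[of s] by simp

lemma g_abs_measurable: "(\<lambda>s. g \<bar>s\<bar>) \<in> borel_measurable borel"
proof -
  obtain b :: 'a where b: "b \<in> Basis" using nonempty_Basis by blast
  have "(\<lambda>s. G (s *\<^sub>R b)) \<in> borel_measurable borel" by measurable
  then show ?thesis using b by (simp add: G_eq)
qed

text \<open>
  Condition (LD) in terms of potentials, by integration in polar coordinates.
\<close>

lemma ball_potential_centre:
  assumes r: "R\<^sub>0 < r"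
  shows "ball_potential y y r \<le> ennreal (C * \<omega> * r ^ d * \<gamma> r)"
proof -
  let ?q = "\<lambda>s. g \<bar>s\<bar> * indicator {..<r} s"
  have [measurable]: "?q \<in> borel_measurable borel"
    using g_abs_measurable by measurable
  have [measurable]: "(\<lambda>x::'a. ?q (norm x)) \<in> borel_measurable borel"
    by (rule measurable_compose[of norm borel borel ?q]) measurable
  have r0: "0 < r" using r R0 by linarith
  have "ball_potential y y r = (\<integral>\<^sup>+x. ?q (norm (- y + x)) \<partial>lborel)"
    unfolding ball_potential_def
    by (intro nn_integral_cong) (auto simp: G_eq dist_norm norm_minus_commute indicator_def)
  also have "\<dots> = (\<integral>\<^sup>+x. ?q (norm x) \<partial>distr lborel borel ((+) (- y)))"
    by (rule nn_integral_distr[where T = "(+) (- y)" and M = lborel and M' = borel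
          and f = "\<lambda>x. ?q (norm x)", symmetric]) measurable
  also have "\<dots> = (\<integral>\<^sup>+x. ?q (norm (x::'a)) \<partial>lborel)"
    by (simp add: lborel_distr_plus)
  also have "\<dots> = ennreal (d * \<omega>) * (\<integral>\<^sup>+s\<in>{0<..}. ennreal (s ^ (d - 1)) * ?q s \<partial>lborel)"
    unfolding d_eq \<omega>_eq by (rule nn_integral_radial) measurable
  also have "(\<integral>\<^sup>+s\<in>{0<..}. ennreal (s ^ (d - 1)) * ?q s \<partial>lborel)
      = (\<integral>\<^sup>+s\<in>{0<..<r}. ennreal (s ^ (d - 1)) * g s \<partial>lborel)"
    by (intro nn_integral_cong) (auto simp: indicator_def)
  also have "ennreal (d * \<omega>) * \<dots> = ennreal \<omega> * (of_nat d * \<dots>)"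
    using \<omega>_pos by (simp add: ennreal_mult ennreal_of_nat_eq_real_of_nat mult_ac)
  also have "\<dots> \<le> ennreal \<omega> * (ennreal (C * r ^ d) * g r)"
    using LD[OF r] by (intro mult_left_mono) (auto simp: d_eq)
  also have "\<dots> = ennreal (C * \<omega> * r ^ d * \<gamma> r)"
    using \<omega>_pos C r0 \<gamma>_pos[OF r0] by (simp add: g_eq ennreal_mult[symmetric] mult_ac)
  finally show ?thesis .
qed

lemma ball_potential_mono: "ball z r \<subseteq> ball z' r' \<Longrightarrow> ball_potential y z r \<le> ball_potential y z' r'"
  unfolding ball_potential_def by (intro nn_integral_mono) (auto simp: indicator_def)

lemma ball_potential_ge:
  assumes "0 < r"
  shows "ennreal (\<omega> * r ^ d * \<gamma> (norm (y - z) + r)) \<le> ball_potential y z r"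
proof -
  have s: "0 < norm (y - z) + r" using assms by (simp add: add_nonneg_pos)
  have "ennreal (\<omega> * r ^ d * \<gamma> (norm (y - z) + r)) = (\<integral>\<^sup>+x. g (norm (y - z) + r) * indicator (ball z r) x \<partial>lborel)"
    unfolding g_eq[OF s] using assms by (intro nn_integral_const_ball[symmetric]) auto
  also have "\<dots> \<le> ball_potential y z r"
    unfolding ball_potential_def
  proof (rule nn_integral_mono)
    fix x
    show "g (norm (y - z) + r) * indicator (ball z r) x \<le> G (y - x) * indicator (ball z r) x"
    proof (cases "x \<in> ball z r")
      case True
      then have "norm (y - x) \<le> norm (y - z) + r"
        using norm_triangle_ineq[of "y - z" "z - x"] by (simp add: dist_norm)
      then show ?thesis using True by (simp add: G_eq g_mono)
    qed simp
  qed
  finally show ?thesis .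
qed

text \<open>
  The ball of radius \<open>r/2\<close> alone contributes \<open>\<omega> (r/2)\<^sup>d \<gamma>(r/2)\<close> to the integral bounded by (LD).
\<close>

lemma \<gamma>_doubling:
  assumes r: "R\<^sub>0 < r"
  shows "\<gamma> (r / 2) \<le> C * 2 ^ d * \<gamma> r"
proof -
  have r0: "0 < r" using r R0 by linarith
  have "ennreal (\<omega> * (r/2) ^ d * \<gamma> (r/2)) = (\<integral>\<^sup>+x. g (r/2) * indicator (ball (0::'a) (r/2)) x \<partial>lborel)"
    using r0 by (simp only: g_eq half_gt_zero) (intro nn_integral_const_ball[symmetric], auto)
  also have "\<dots> \<le> ball_potential 0 0 (r/2)"
    unfolding ball_potential_def
    by (intro nn_integral_mono) (auto simp: indicator_def G_eq intro!: g_mono)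
  also have "\<dots> \<le> ball_potential 0 0 r"
    using r0 by (intro ball_potential_mono) auto
  also have "\<dots> \<le> ennreal (C * \<omega> * r ^ d * \<gamma> r)"
    by (rule ball_potential_centre[OF r])
  finally have "\<omega> * (r/2) ^ d * \<gamma> (r/2) \<le> C * \<omega> * r ^ d * \<gamma> r"
    using C \<omega>_pos r0 \<gamma>_pos[OF r0] by simp
  then have "(\<omega> * (r/2) ^ d) * \<gamma> (r/2) \<le> (\<omega> * (r/2) ^ d) * (C * 2 ^ d * \<gamma> r)"
    by (simp add: power_divide mult_ac)
  then show ?thesis
    using r0 \<omega>_pos by (subst (asm) mult_le_cancel_left_pos) auto
qed

text \<open>
  Two upper bounds for the potential of a ball: far away it is governed by the distance, nearby the
  ball is enclosed in a ball of radius \<open>3 r\<close> around \<open>y\<close>.  Together they give \<open>K \<omega> r\<^sup>d\<close> times the smaller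
  of \<open>\<gamma>(r)\<close> and \<open>\<gamma>(|y - z|)\<close>; in the far case the second of these needs doubling.
\<close>

lemma ball_potential_far:
  assumes r: "R\<^sub>0 < r" and far: "2 * r \<le> norm (y - z)"
  shows "ball_potential y z r \<le> ennreal (\<omega> * r ^ d * \<gamma> (norm (y - z) / 2))"
proof -
  have r0: "0 < r" using r R0 by linarith
  have s: "0 < norm (y - z) / 2" using r0 far by linarith
  have "ball_potential y z r \<le> (\<integral>\<^sup>+x. g (norm (y - z) / 2) * indicator (ball z r) x \<partial>lborel)"
    unfolding ball_potential_def
  proof (rule nn_integral_mono)
    fix x
    show "G (y - x) * indicator (ball z r) x \<le> g (norm (y - z) / 2) * indicator (ball z r) x"
    proof (cases "x \<in> ball z r")
      case True
      then have "norm (x - z) < r" by (simp add: dist_norm norm_minus_commute)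
      then have "norm (y - z) / 2 \<le> norm (y - x)"
        using norm_triangle_ineq[of "y - x" "x - z"] far by simp
      then show ?thesis using True s by (simp add: G_eq g_mono)
    qed simp
  qed
  also have "\<dots> = ennreal (\<omega> * r ^ d * \<gamma> (norm (y - z) / 2))"
    unfolding g_eq[OF s] using r0 by (intro nn_integral_const_ball) auto
  finally show ?thesis .
qed

lemma ball_potential_near:
  assumes r: "R\<^sub>0 < r" and near: "norm (y - z) < 2 * r"
  shows "ball_potential y z r \<le> ennreal (K * (\<omega> * r ^ d) * \<gamma> (3 * r))"
proof -
  have r0: "0 < r" using r R0 by linarith
  have "ball z r \<subseteq> ball y (3 * r)"
  proof
    fix x assume "x \<in> ball z r"
    then show "x \<in> ball y (3 * r)"
      using near dist_triangle[of y x z] by (simp add: dist_norm)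
  qed
  then have "ball_potential y z r \<le> ball_potential y y (3 * r)"
    by (rule ball_potential_mono)
  also have "\<dots> \<le> ennreal (C * \<omega> * (3 * r) ^ d * \<gamma> (3 * r))"
    using r r0 by (intro ball_potential_centre) linarith
  finally show ?thesis by (simp add: K_eq power_mult_distrib mult_ac)
qed

lemma C2_le_K: "C * 2 ^ d \<le> K" and one_le_K: "1 \<le> K"
proof -
  have "(2::real) ^ d \<le> 3 ^ d" by (intro power_mono) auto
  then show "C * 2 ^ d \<le> K" unfolding K_eq using C by (intro mult_left_mono) auto
  have "(1::real) \<le> 3 ^ d" by (intro one_le_power) auto
  then show "1 \<le> K" unfolding K_eq using C mult_mono[of 1 C 1 "3 ^ d"] by simp
qed

lemma ball_potential_le_radius:
  assumes r: "R\<^sub>0 < r"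
  shows "ball_potential y z r \<le> ennreal (K * (\<omega> * r ^ d) * \<gamma> r)"
proof (cases "norm (y - z) < 2 * r")
  case True
  have r0: "0 < r" using r R0 by linarith
  have "K * (\<omega> * r ^ d) * \<gamma> (3 * r) \<le> K * (\<omega> * r ^ d) * \<gamma> r"
    using r0 one_le_K \<omega>_pos by (intro mult_left_mono \<gamma>_mono) auto
  then show ?thesis using ball_potential_near[OF r True] by (meson ennreal_leI order_trans)
next
  case False
  have r0: "0 < r" using r R0 by linarith
  have "1 * (\<omega> * r ^ d) * \<gamma> (norm (y - z) / 2) \<le> K * (\<omega> * r ^ d) * \<gamma> r"
    using r0 \<omega>_pos one_le_K False \<gamma>_pos[OF r0]
    by (intro mult_mono \<gamma>_mono) (auto intro: less_imp_le \<gamma>_pos)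
  then show ?thesis using ball_potential_far[OF r, of y z] False
    by (simp add: not_less) (meson ennreal_leI order_trans)
qed

lemma ball_potential_le_distance:
  assumes r: "R\<^sub>0 < r" and "y \<noteq> z"
  shows "ball_potential y z r \<le> ennreal (K * (\<omega> * r ^ d) * \<gamma> (norm (y - z)))"
proof (cases "norm (y - z) < 2 * r")
  case True
  have r0: "0 < r" using r R0 by linarith
  have "K * (\<omega> * r ^ d) * \<gamma> (3 * r) \<le> K * (\<omega> * r ^ d) * \<gamma> (norm (y - z))"
    using r0 one_le_K \<omega>_pos True \<open>y \<noteq> z\<close> by (intro mult_left_mono \<gamma>_mono) auto
  then show ?thesis using ball_potential_near[OF r True] by (meson ennreal_leI order_trans)
next
  case False
  have r0: "0 < r" using r R0 by linarith
  have s: "R\<^sub>0 < norm (y - z)" "0 < norm (y - z)" using False r r0 by linarith+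
  have "\<gamma> (norm (y - z) / 2) \<le> C * 2 ^ d * \<gamma> (norm (y - z))"
    by (rule \<gamma>_doubling[OF s(1)])
  also have "\<dots> \<le> K * \<gamma> (norm (y - z))"
    using C2_le_K \<gamma>_pos[OF s(2)] by (intro mult_right_mono) auto
  finally have "(\<omega> * r ^ d) * \<gamma> (norm (y - z) / 2) \<le> (\<omega> * r ^ d) * (K * \<gamma> (norm (y - z)))"
    using r0 \<omega>_pos by (intro mult_left_mono) auto
  then have "(\<omega> * r ^ d) * \<gamma> (norm (y - z) / 2) \<le> K * (\<omega> * r ^ d) * \<gamma> (norm (y - z))"
    by (simp only: mult_ac)
  then show ?thesis using ball_potential_far[OF r, of y z] False
    by (simp only: not_less) (meson ennreal_leI order_trans)
qed

definition weight :: "real \<Rightarrow> real" where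
  "weight r = 1 / (\<omega> * r ^ d * \<gamma> r)"

lemma weight_pos: "0 < r \<Longrightarrow> 0 < weight r"
  using \<gamma>_pos[of r] \<omega>_pos by (simp add: weight_def)

lemma weight_cancel:
  assumes "0 < r"
  shows "weight r * (k * (\<omega> * r ^ d) * t) = k * (t / \<gamma> r)"
  using assms \<gamma>_pos[of r] \<omega>_pos by (simp add: weight_def)

text \<open>
  The potential of the ball, scaled to be of order \<open>1\<close> on the ball; up to constants this is the
  probability of hitting the ball from \<open>y\<close>.
\<close>

definition normalized_potential :: "'a \<Rightarrow> 'a \<Rightarrow> real \<Rightarrow> ennreal" where
  "normalized_potential y z r = ennreal (weight r) * ball_potential y z r"

lemma normalized_potential_le_K:
  assumes r: "R\<^sub>0 < r"
  shows "normalized_potential y z r \<le> ennreal K"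
proof -
  have r0: "0 < r" using r R0 by linarith
  have "normalized_potential y z r \<le> ennreal (weight r) * ennreal (K * (\<omega> * r ^ d) * \<gamma> r)"
    unfolding normalized_potential_def by (intro mult_left_mono ball_potential_le_radius[OF r]) simp
  also have "\<dots> = ennreal (weight r * (K * (\<omega> * r ^ d) * \<gamma> r))"
    using weight_pos[OF r0] by (intro ennreal_mult'[symmetric]) simp
  also have "\<dots> = ennreal K"
    unfolding weight_cancel[OF r0] using \<gamma>_pos[OF r0] by simp
  finally show ?thesis .
qed

lemma normalized_potential_le:
  assumes r: "R\<^sub>0 < r" and "y \<noteq> z"
  shows "normalized_potential y z r \<le> ennreal (K * (\<gamma> (norm (y - z)) / \<gamma> r))"
proof -
  have r0: "0 < r" using r R0 by linarith
  have "normalized_potential y z r \<le> ennreal (weight r) * ennreal (K * (\<omega> * r ^ d) * \<gamma> (norm (y - z)))"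
    unfolding normalized_potential_def by (intro mult_left_mono ball_potential_le_distance assms) simp
  also have "\<dots> = ennreal (weight r * (K * (\<omega> * r ^ d) * \<gamma> (norm (y - z))))"
    using weight_pos[OF r0] by (intro ennreal_mult'[symmetric]) simp
  finally show ?thesis
    unfolding weight_cancel[OF r0] .
qed

lemma normalized_potential_ge:
  assumes r0: "0 < r"
  shows "ennreal (\<gamma> (norm (y - z) + r) / \<gamma> r) \<le> normalized_potential y z r"
proof -
  have "ennreal (\<gamma> (norm (y - z) + r) / \<gamma> r) = ennreal (weight r * (1 * (\<omega> * r ^ d) * \<gamma> (norm (y - z) + r)))"
    unfolding weight_cancel[OF r0] by simp
  also have "\<dots> = ennreal (weight r) * ennreal (\<omega> * r ^ d * \<gamma> (norm (y - z) + r))"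
    using weight_pos[OF r0] by (simp add: ennreal_mult')
  also have "\<dots> \<le> normalized_potential y z r"
    unfolding normalized_potential_def by (intro mult_left_mono ball_potential_ge[OF r0]) simp
  finally show ?thesis .
qed

lemma normalized_potential_on_ball:
  assumes r: "R\<^sub>0 < r" and y: "y \<in> ball z r"
  shows "1 \<le> ennreal (C * 2 ^ d) * normalized_potential y z r"
proof -
  have r0: "0 < r" using r R0 by linarith
  have "norm (y - z) < r" using y by (simp add: dist_norm norm_minus_commute)
  then have s: "0 < norm (y - z) + r" "norm (y - z) + r \<le> 2 * r" using r0 by (simp_all add: add_nonneg_pos)
  have "\<gamma> r = \<gamma> ((2 * r) / 2)" by simp
  also have "\<dots> \<le> C * 2 ^ d * \<gamma> (2 * r)"
    using r r0 by (intro \<gamma>_doubling) linarith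
  also have "\<dots> \<le> C * 2 ^ d * \<gamma> (norm (y - z) + r)"
    using C s by (intro mult_left_mono \<gamma>_mono) auto
  finally have "1 \<le> C * 2 ^ d * (\<gamma> (norm (y - z) + r) / \<gamma> r)"
    using \<gamma>_pos[OF r0] by simp
  then have "ennreal 1 \<le> ennreal (C * 2 ^ d * (\<gamma> (norm (y - z) + r) / \<gamma> r))"
    by (rule ennreal_leI)
  also have "\<dots> = ennreal (C * 2 ^ d) * ennreal (\<gamma> (norm (y - z) + r) / \<gamma> r)"
    using C by (intro ennreal_mult') simp
  also have "\<dots> \<le> ennreal (C * 2 ^ d) * normalized_potential y z r"
    by (intro mult_left_mono normalized_potential_ge[OF r0]) simp
  finally show ?thesis by simp
qed

end

section \<open>Regularly located balls\<close>

locale regular_balls = radial_green G g R\<^sub>0 C d \<omega> K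
  for G :: "'a::euclidean_space \<Rightarrow> ennreal" and g R\<^sub>0 C d \<omega> K +
  fixes Z :: "'a set" and r :: "'a \<Rightarrow> real" and \<phi> :: "real \<Rightarrow> real" and \<epsilon> R :: real
  assumes Z_nonzero: "0 \<notin> Z"
    and radii: "\<And>z. z \<in> Z \<Longrightarrow> R\<^sub>0 < r z"
    and \<epsilon>: "0 < \<epsilon>" and separated: "separated_by \<epsilon> Z"
    and R: "0 < R" and dense: "\<And>x. ball x R \<inter> Z \<noteq> {}"
    and \<phi>_antimono: "antimono_on {0..} \<phi>" and \<phi>_pos: "\<And>t. t \<ge> 0 \<Longrightarrow> \<phi> t > 0"
    and radii_\<phi>: "\<And>z. z \<in> Z \<Longrightarrow> r z = \<phi> (norm z)"
begin

definition q :: "real \<Rightarrow> ennreal" where "q s = ennreal (\<gamma> s / \<gamma> (\<phi> s))"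

definition Z_upto :: "real \<Rightarrow> 'a set" where "Z_upto n = {z\<in>Z. norm z \<le> n}"

definition shell :: "real \<Rightarrow> ennreal" where
  "shell n = (\<integral>\<^sup>+x\<in>{x::'a. 1 < norm x \<and> norm x \<le> n}. q (norm x) \<partial>lborel)"

text \<open>
  The volume of the shifted balls in \<open>sum_separated_le_radial_integral\<close>.
\<close>

definition inner_volume :: real where "inner_volume = \<omega> * (\<epsilon>/4) ^ d"

text \<open>
  A bound for the number of centres in any ball of radius \<open>1 + \<epsilon>\<close>.
\<close>

definition near_bound :: nat where "near_bound = nat \<lfloor>((1 + \<epsilon> + \<epsilon>/2) / (\<epsilon>/2)) ^ d\<rfloor>"

lemma inner_volume_pos: "0 < inner_volume" using \<omega>_pos \<epsilon> by (simp add: inner_volume_def)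

lemma r_pos: "z \<in> Z \<Longrightarrow> 0 < r z" using radii[of z] R0 by linarith

lemma \<phi>_mono: "0 \<le> s \<Longrightarrow> s \<le> t \<Longrightarrow> \<phi> t \<le> \<phi> s"
  using monotone_onD[OF \<phi>_antimono, of s t] by simp

lemma \<gamma>_\<phi>_mono: "0 \<le> s \<Longrightarrow> s \<le> t \<Longrightarrow> \<gamma> (\<phi> s) \<le> \<gamma> (\<phi> t)"
  using \<phi>_mono[of s t] \<phi>_pos[of t] by (intro \<gamma>_mono) auto

lemma q_antimono: "antimono_on {0<..} q"
  unfolding monotone_on_def q_def
proof (intro ballI impI ennreal_leI)
  fix s t :: real assume "s \<in> {0<..}" "t \<in> {0<..}" "s \<le> t"
  then show "\<gamma> t / \<gamma> (\<phi> t) \<le> \<gamma> s / \<gamma> (\<phi> s)"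
    using \<gamma>_pos[of "\<phi> s"] \<phi>_pos[of s]
    by (intro frac_le \<gamma>_mono \<gamma>_\<phi>_mono) auto
qed

lemma q_abs_measurable: "(\<lambda>s. q \<bar>s\<bar>) \<in> borel_measurable borel"
proof -
  have "mono (\<lambda>t. - \<phi> (max 0 t))"
    by (intro monoI le_imp_neg_le \<phi>_mono) auto
  then have "(\<lambda>t. - \<phi> (max 0 t)) \<in> borel_measurable borel"
    by (rule borel_measurable_mono)
  then have "(\<lambda>t. - (- \<phi> (max 0 t))) \<in> borel_measurable borel"
    by (rule borel_measurable_uminus)
  then have [measurable]: "(\<lambda>t. \<phi> (max 0 t)) \<in> borel_measurable borel" by simp
  have [measurable]: "(\<lambda>s. \<phi> \<bar>s\<bar>) \<in> borel_measurable borel"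
    using measurable_compose[of abs borel borel "\<lambda>t. \<phi> (max 0 t)"] by simp
  note [measurable] = g_abs_measurable
  have "(\<lambda>s. ennreal (enn2real (g \<bar>s\<bar>) / enn2real (g \<bar>\<phi> \<bar>s\<bar>\<bar>))) \<in> borel_measurable borel"
    using measurable_compose[of "\<lambda>s. \<phi> \<bar>s\<bar>" borel borel "\<lambda>s. g \<bar>s\<bar>"] by measurable
  also have "(\<lambda>s. ennreal (enn2real (g \<bar>s\<bar>) / enn2real (g \<bar>\<phi> \<bar>s\<bar>\<bar>))) = (\<lambda>s. q \<bar>s\<bar>)"
    using \<phi>_pos[of "\<bar>_\<bar>"] by (simp add: q_def \<gamma>_def fun_eq_iff abs_of_pos)
  finally show ?thesis .
qed

lemma q_norm_measurable: "(\<lambda>x::'a. q (norm x)) \<in> borel_measurable borel"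
  using measurable_compose[of norm borel borel, OF _ q_abs_measurable] by simp

lemma card_near: "finite {z\<in>Z. norm (z - y) < 1 + \<epsilon>} \<and> card {z\<in>Z. norm (z - y) < 1 + \<epsilon>} \<le> near_bound"
  unfolding near_bound_def unfolding d_eq
  by (rule separated_ball_card[OF \<epsilon>, of _ y])
    (auto simp: dist_norm norm_minus_commute intro: separated_by_subset[OF separated])

lemma finite_Z_upto: "finite (Z_upto n)"
proof -
  have "Z_upto n \<subseteq> ball 0 (n + 1)" by (auto simp: Z_upto_def)
  then show ?thesis
    using separated_ball_card[OF \<epsilon>, of "Z_upto n" 0 "n + 1"] separated_by_subset[OF separated]
    by (auto simp: Z_upto_def)
qed

lemma Z_infinite: "infinite Z"
proof
  assume "finite Z"
  then have "bounded Z" by (rule finite_imp_bounded)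
  then obtain B where B: "0 < B" "\<And>z. z \<in> Z \<Longrightarrow> norm z \<le> B" by (meson bounded_pos)
  obtain b :: 'a where b: "b \<in> Basis" using nonempty_Basis by blast
  obtain z where z: "z \<in> Z" "dist ((B + R) *\<^sub>R b) z < R" using dense[of "(B + R) *\<^sub>R b"] by auto
  have "norm ((B + R) *\<^sub>R b) \<le> norm z + dist ((B + R) *\<^sub>R b) z"
    using norm_triangle_ineq[of z "(B + R) *\<^sub>R b - z"] by (simp add: dist_norm)
  then show False using B z b R by fastforce
qed

lemma shell_finite: "shell n < \<infinity>"
proof -
  have "shell n \<le> (\<integral>\<^sup>+x. q 1 * indicator (cball (0::'a) n) x \<partial>lborel)"
    unfolding shell_def
    using monotone_onD[OF q_antimono, of 1]
    by (intro nn_integral_mono) (auto simp: indicator_def)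
  also have "\<dots> = q 1 * emeasure lborel (cball (0::'a) n)"
    by (rule nn_integral_cmult_indicator) simp
  also have "\<dots> < \<infinity>"
    using emeasure_compact_finite[of "cball (0::'a) n"]
    by (simp add: q_def ennreal_mult_less_top)
  finally show ?thesis .
qed

lemma sum_le_shell:
  fixes Y :: "'a set"
  assumes "finite Y" "separated_by \<epsilon> Y" "\<And>z. z \<in> Y \<Longrightarrow> 1 + \<epsilon> \<le> norm z" "\<And>z. z \<in> Y \<Longrightarrow> norm z \<le> n"
  shows "ennreal inner_volume * (\<Sum>z\<in>Y. q (norm z)) \<le> shell n"
  unfolding inner_volume_def shell_def unfolding d_eq \<omega>_eq
  by (rule sum_separated_le_radial_integral[OF assms(1) \<epsilon> assms(2) q_antimono assms(3,4)])

text \<open>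
  The term of \<open>z\<close> is at most \<open>K g(|y - z|) / g(\<phi>(|z|))\<close>.  If \<open>z\<close> is closer to the origin than to \<open>y\<close>,
  replace \<open>|y - z|\<close> by \<open>|z|\<close> in the numerator; otherwise replace \<open>|z|\<close> by \<open>|y - z|\<close> in the denominator.
  Either way the bound becomes \<open>K q\<close> at a point of a separated set in the ball of radius \<open>n\<close>, which is
  \<open>Z\<close> in the first case and its translate \<open>Z - y\<close> in the second.  The centres close to \<open>y\<close> or to the
  origin are few, and each contributes at most \<open>K\<close>.
\<close>

lemma sum_normalized_potential_le:
  "(\<Sum>z\<in>Z_upto n. normalized_potential y z (r z)) \<le> ennreal (2 * real near_bound * K) + ennreal (2 * K / inner_volume) * shell n"
proof -
  define near where "near = {z\<in>Z_upto n. norm (z - y) < 1 + \<epsilon> \<or> norm (z - 0) < 1 + \<epsilon>}"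
  define F1 where "F1 = {z\<in>Z_upto n. 1 + \<epsilon> \<le> norm (z - y) \<and> 1 + \<epsilon> \<le> norm z \<and> norm z \<le> norm (z - y)}"
  define F2 where "F2 = {z\<in>Z_upto n. 1 + \<epsilon> \<le> norm (z - y) \<and> 1 + \<epsilon> \<le> norm z \<and> norm (z - y) < norm z}"
  have split: "Z_upto n = near \<union> (F1 \<union> F2)" "near \<inter> (F1 \<union> F2) = {}" "F1 \<inter> F2 = {}"
    by (auto simp: near_def F1_def F2_def)
  have fin: "finite near" "finite F1" "finite F2"
    using finite_Z_upto[of n] by (auto simp: near_def F1_def F2_def)
  have K0: "0 \<le> K" using one_le_K by simp
  have "card near \<le> card ({z\<in>Z. norm (z - y) < 1 + \<epsilon>} \<union> {z\<in>Z. norm (z - 0) < 1 + \<epsilon>})"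
    using card_near[of y] card_near[of 0] by (intro card_mono) (auto simp: near_def Z_upto_def)
  also have "\<dots> \<le> 2 * near_bound"
    using card_near[of y] card_near[of 0] by (intro order_trans[OF card_Un_le]) simp
  finally have card: "card near \<le> 2 * near_bound" .
  have "(\<Sum>z\<in>near. normalized_potential y z (r z)) \<le> (\<Sum>z\<in>near. ennreal K)"
    using radii by (intro sum_mono normalized_potential_le_K) (auto simp: near_def Z_upto_def)
  also have "\<dots> = ennreal (real (card near) * K)"
    using K0 by (simp add: ennreal_mult ennreal_of_nat_eq_real_of_nat)
  also have "\<dots> \<le> ennreal (2 * real near_bound * K)"
    using card K0 by (intro ennreal_leI mult_right_mono) auto
  finally have near: "(\<Sum>z\<in>near. normalized_potential y z (r z)) \<le> ennreal (2 * real near_bound * K)" .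
  have F1: "ennreal inner_volume * (\<Sum>z\<in>F1. normalized_potential y z (r z)) \<le> ennreal K * shell n"
  proof -
    have "(\<Sum>z\<in>F1. normalized_potential y z (r z)) \<le> (\<Sum>z\<in>F1. ennreal K * q (norm z))"
    proof (rule sum_mono)
      fix z assume z: "z \<in> F1"
      then have zZ: "z \<in> Z" "norm z \<le> norm (y - z)" "0 < norm z" "y \<noteq> z"
        using \<epsilon> by (auto simp: F1_def Z_upto_def norm_minus_commute)
      have "\<gamma> (norm (y - z)) / \<gamma> (r z) \<le> \<gamma> (norm z) / \<gamma> (\<phi> (norm z))"
        using zZ \<gamma>_pos[OF r_pos[OF zZ(1)]] by (simp add: radii_\<phi> divide_right_mono \<gamma>_mono)
      then have "K * (\<gamma> (norm (y - z)) / \<gamma> (r z)) \<le> K * (\<gamma> (norm z) / \<gamma> (\<phi> (norm z)))"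
        using K0 by (rule mult_left_mono)
      then show "normalized_potential y z (r z) \<le> ennreal K * q (norm z)"
        using order_trans[OF normalized_potential_le[OF radii[OF zZ(1)] zZ(4)] ennreal_leI] K0
        unfolding q_def ennreal_mult'[OF K0, symmetric] by blast
    qed
    then have "ennreal inner_volume * (\<Sum>z\<in>F1. normalized_potential y z (r z)) \<le> ennreal inner_volume * (ennreal K * (\<Sum>z\<in>F1. q (norm z)))"
      unfolding sum_distrib_left[symmetric] by (rule mult_left_mono) simp
    also have "\<dots> = ennreal K * (ennreal inner_volume * (\<Sum>z\<in>F1. q (norm z)))"
      by (simp only: mult_ac)
    also have "\<dots> \<le> ennreal K * shell n"
      using fin separated_by_subset[OF separated]
      by (intro mult_left_mono sum_le_shell) (auto simp: F1_def Z_upto_def)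
    finally show ?thesis .
  qed
  have F2: "ennreal inner_volume * (\<Sum>z\<in>F2. normalized_potential y z (r z)) \<le> ennreal K * shell n"
  proof -
    have "(\<Sum>z\<in>F2. normalized_potential y z (r z)) \<le> (\<Sum>z\<in>F2. ennreal K * q (norm (z - y)))"
    proof (rule sum_mono)
      fix z assume z: "z \<in> F2"
      then have zZ: "z \<in> Z" "norm (z - y) \<le> norm z" "0 < norm (z - y)" "y \<noteq> z"
        using \<epsilon> by (auto simp: F2_def Z_upto_def)
      have "\<gamma> (norm (y - z)) / \<gamma> (r z) \<le> \<gamma> (norm (z - y)) / \<gamma> (\<phi> (norm (z - y)))"
        using zZ \<gamma>_pos[of "\<phi> (norm (z - y))"] \<phi>_pos[of "norm (z - y)"]
        by (subst norm_minus_commute) (simp add: radii_\<phi> divide_left_mono frac_le \<gamma>_\<phi>_mono)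
      then have "K * (\<gamma> (norm (y - z)) / \<gamma> (r z)) \<le> K * (\<gamma> (norm (z - y)) / \<gamma> (\<phi> (norm (z - y))))"
        using K0 by (rule mult_left_mono)
      then show "normalized_potential y z (r z) \<le> ennreal K * q (norm (z - y))"
        using order_trans[OF normalized_potential_le[OF radii[OF zZ(1)] zZ(4)] ennreal_leI] K0
        unfolding q_def ennreal_mult'[OF K0, symmetric] by blast
    qed
    then have "ennreal inner_volume * (\<Sum>z\<in>F2. normalized_potential y z (r z)) \<le> ennreal inner_volume * (ennreal K * (\<Sum>z\<in>F2. q (norm (z - y))))"
      unfolding sum_distrib_left[symmetric] by (rule mult_left_mono) simp
    also have "\<dots> = ennreal K * (ennreal inner_volume * (\<Sum>v\<in>(\<lambda>z. z - y) ` F2. q (norm v)))"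
      by (simp add: sum.reindex inj_on_def mult_ac)
    also have "\<dots> \<le> ennreal K * shell n"
    proof (intro mult_left_mono sum_le_shell)
      show "separated_by \<epsilon> ((\<lambda>z. z - y) ` F2)"
        using separated by (auto simp: separated_by_def F2_def Z_upto_def)
    qed (use fin in \<open>auto simp: F2_def Z_upto_def\<close>)
    finally show ?thesis .
  qed
  have far: "(\<Sum>z\<in>F1 \<union> F2. normalized_potential y z (r z)) \<le> ennreal (2 * K / inner_volume) * shell n"
  proof -
    let ?S = "\<Sum>z\<in>F1 \<union> F2. normalized_potential y z (r z)"
    have "ennreal inner_volume * ?S \<le> ennreal K * shell n + ennreal K * shell n"
      using add_mono[OF F1 F2] fin split(3) by (simp add: sum.union_disjoint distrib_left)
    also have "\<dots> = ennreal (2 * K) * shell n"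
      using K0 by (simp add: distrib_right[symmetric] ennreal_plus[symmetric] del: ennreal_plus)
    finally have "ennreal (1 / inner_volume) * (ennreal inner_volume * ?S) \<le> ennreal (1 / inner_volume) * (ennreal (2 * K) * shell n)"
      by (intro mult_left_mono) auto
    moreover have "ennreal (1 / inner_volume) * (ennreal inner_volume * ?S) = ?S"
      using inner_volume_pos by (simp add: mult.assoc[symmetric] ennreal_mult[symmetric])
    moreover have "ennreal (1 / inner_volume) * (ennreal (2 * K) * shell n) = ennreal (2 * K / inner_volume) * shell n"
      using inner_volume_pos K0 by (simp add: mult.assoc[symmetric] ennreal_mult[symmetric])
    ultimately show ?thesis by simp
  qed
  have "(\<Sum>z\<in>Z_upto n. normalized_potential y z (r z)) = (\<Sum>z\<in>near. normalized_potential y z (r z)) + (\<Sum>z\<in>F1 \<union> F2. normalized_potential y z (r z))"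
    using split fin by (simp add: sum.union_disjoint)
  also have "\<dots> \<le> ennreal (2 * real near_bound * K) + ennreal (2 * K / inner_volume) * shell n"
    by (intro add_mono near far)
  finally show ?thesis .
qed

text \<open>
  For \<open>|z| \<ge> |y| + \<phi>(0)\<close> all points of the ball around \<open>z\<close> are within \<open>2 |z|\<close> of \<open>y\<close>, so by doubling the
  term of \<open>z\<close> is at least a constant times \<open>q(|z|)\<close>.  The constant does not depend on \<open>y\<close>; only the
  part \<open>\<kappa>\<close> of the integral near the origin does.
\<close>

lemma shell_le_sum_normalized_potential:
  "\<exists>\<kappa><\<infinity>. \<forall>n. shell n \<le> \<kappa> + ennreal (\<omega> * (2*R) ^ d * (C * 2 ^ d)) * (\<Sum>z\<in>Z_upto n. normalized_potential y z (r z))"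
proof (intro exI[of _ "shell (norm y + \<phi> 0 + 2*R)"] conjI allI)
  let ?L = "norm y + \<phi> 0"
  have L: "0 < ?L" using \<phi>_pos[of 0] by (simp add: add_nonneg_pos)
  fix n
  note [measurable] = q_norm_measurable
  have "shell n \<le> (\<integral>\<^sup>+x. q (norm (x::'a)) * indicator {x. 1 < norm x \<and> norm x \<le> ?L + 2*R} x
      + q (norm x) * indicator {x. ?L + 2*R \<le> norm x \<and> norm x \<le> n} x \<partial>lborel)"
    unfolding shell_def by (intro nn_integral_mono) (auto simp: indicator_def)
  also have "\<dots> = shell (?L + 2*R) + (\<integral>\<^sup>+x\<in>{x::'a. ?L + 2*R \<le> norm x \<and> norm x \<le> n}. q (norm x) \<partial>lborel)"
    unfolding shell_def by (rule nn_integral_add) measurable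
  also have "\<dots> \<le> shell (?L + 2*R) + ennreal (\<omega> * (2*R) ^ d) * (\<Sum>z\<in>{z\<in>Z. ?L \<le> norm z \<and> norm z \<le> n}. q (norm z))"
    unfolding \<omega>_eq d_eq
    using dense R L finite_Z_upto[of n] q_antimono
    by (intro add_left_mono radial_integral_le_sum) (auto simp: Z_upto_def)
  also have "\<dots> \<le> shell (?L + 2*R) + ennreal (\<omega> * (2*R) ^ d) * (\<Sum>z\<in>Z_upto n. ennreal (C * 2 ^ d) * normalized_potential y z (r z))"
  proof (intro add_left_mono mult_left_mono)
    have "(\<Sum>z\<in>{z\<in>Z. ?L \<le> norm z \<and> norm z \<le> n}. q (norm z))
      \<le> (\<Sum>z\<in>{z\<in>Z. ?L \<le> norm z \<and> norm z \<le> n}. ennreal (C * 2 ^ d) * normalized_potential y z (r z))"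
    proof (rule sum_mono)
      fix z assume "z \<in> {z\<in>Z. ?L \<le> norm z \<and> norm z \<le> n}"
      then have z: "z \<in> Z" "?L \<le> norm z" by auto
      have rz: "r z \<le> \<phi> 0" using \<phi>_mono[of 0 "norm z"] z by (simp add: radii_\<phi>)
      have R0z: "R\<^sub>0 < 2 * norm z" using radii[OF z(1)] rz z(2) r_pos[OF z(1)] norm_ge_zero[of y] by linarith
      have dist: "norm (y - z) + r z \<le> 2 * norm z"
        using norm_triangle_ineq4[of y z] rz z(2) by linarith
      have pos: "0 < norm (y - z) + r z" using r_pos[OF z(1)] by (simp add: add_nonneg_pos)
      have "\<gamma> (norm z) = \<gamma> ((2 * norm z) / 2)" by simp
      also have "\<dots> \<le> C * 2 ^ d * \<gamma> (2 * norm z)" by (rule \<gamma>_doubling[OF R0z])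
      also have "\<dots> \<le> C * 2 ^ d * \<gamma> (norm (y - z) + r z)"
        using C pos dist by (intro mult_left_mono \<gamma>_mono) auto
      finally have "\<gamma> (norm z) / \<gamma> (\<phi> (norm z)) \<le> C * 2 ^ d * (\<gamma> (norm (y - z) + r z) / \<gamma> (r z))"
        using z by (simp add: radii_\<phi> divide_right_mono)
      then have "q (norm z) \<le> ennreal (C * 2 ^ d * (\<gamma> (norm (y - z) + r z) / \<gamma> (r z)))"
        unfolding q_def by (rule ennreal_leI)
      also have "\<dots> = ennreal (C * 2 ^ d) * ennreal (\<gamma> (norm (y - z) + r z) / \<gamma> (r z))"
        using C by (intro ennreal_mult') simp
      also have "\<dots> \<le> ennreal (C * 2 ^ d) * normalized_potential y z (r z)"
        by (intro mult_left_mono normalized_potential_ge r_pos z) simp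
      finally show "q (norm z) \<le> ennreal (C * 2 ^ d) * normalized_potential y z (r z)" .
    qed
    also have "\<dots> \<le> (\<Sum>z\<in>Z_upto n. ennreal (C * 2 ^ d) * normalized_potential y z (r z))"
      using finite_Z_upto[of n] by (intro sum_mono2) (auto simp: Z_upto_def)
    finally show "(\<Sum>z\<in>{z\<in>Z. ?L \<le> norm z \<and> norm z \<le> n}. q (norm z))
      \<le> (\<Sum>z\<in>Z_upto n. ennreal (C * 2 ^ d) * normalized_potential y z (r z))" .
  qed simp
  also have "ennreal (\<omega> * (2*R) ^ d) * (\<Sum>z\<in>Z_upto n. ennreal (C * 2 ^ d) * normalized_potential y z (r z))
    = ennreal (\<omega> * (2*R) ^ d * (C * 2 ^ d)) * (\<Sum>z\<in>Z_upto n. normalized_potential y z (r z))"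
    using C R \<omega>_pos by (simp add: sum_distrib_left[symmetric] ennreal_mult' mult.assoc)
  finally show "shell n \<le> shell (?L + 2*R)
      + ennreal (\<omega> * (2*R) ^ d * (C * 2 ^ d)) * (\<Sum>z\<in>Z_upto n. normalized_potential y z (r z))" .
qed (rule shell_finite)

lemma incseq_shell: "incseq (\<lambda>n. shell (real n))"
  unfolding incseq_def shell_def by (intro allI impI nn_integral_mono) (auto simp: indicator_def)

text \<open>
  The integral of the criterion in polar coordinates.
\<close>

lemma SUP_shell:
  "(SUP n. shell (real n)) = ennreal (d * \<omega>) *
     (\<integral>\<^sup>+s\<in>{1<..}. ennreal (s ^ (d - 1)) * g s / g (\<phi> s) \<partial>lborel)"
proof -
  note [measurable] = q_norm_measurable q_abs_measurable
  have "(SUP n. shell (real n)) = (\<integral>\<^sup>+x. (SUP n. q (norm (x::'a)) * indicator {x. 1 < norm x \<and> norm x \<le> real n} x) \<partial>lborel)"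
    unfolding shell_def
    by (intro nn_integral_monotone_convergence_SUP[symmetric])
      (auto simp: incseq_def le_fun_def indicator_def)
  also have "\<dots> = (\<integral>\<^sup>+x. q \<bar>norm (x::'a)\<bar> * indicator {1<..} (norm x) \<partial>lborel)"
  proof (intro nn_integral_cong antisym SUP_least)
    fix x :: 'a
    obtain n where "norm x \<le> real n" using real_arch_simple by blast
    then show "q \<bar>norm x\<bar> * indicator {1<..} (norm x) \<le> (SUP n. q (norm x) * indicator {x. 1 < norm x \<and> norm x \<le> real n} x)"
      by (intro SUP_upper2[of n]) (auto simp: indicator_def)
  qed (auto simp: indicator_def)
  also have "\<dots> = ennreal (d * \<omega>) * (\<integral>\<^sup>+s\<in>{0<..}. ennreal (s ^ (d - 1)) * (q \<bar>s\<bar> * indicator {1<..} s) \<partial>lborel)"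
    unfolding d_eq \<omega>_eq by (rule nn_integral_radial[where q = "\<lambda>s. q \<bar>s\<bar> * indicator {1<..} s"]) measurable
  also have "(\<integral>\<^sup>+s\<in>{0<..}. ennreal (s ^ (d - 1)) * (q \<bar>s\<bar> * indicator {1<..} s) \<partial>lborel)
      = (\<integral>\<^sup>+s\<in>{1<..}. ennreal (s ^ (d - 1)) * g s / g (\<phi> s) \<partial>lborel)"
  proof (rule nn_integral_cong)
    fix s :: real
    show "ennreal (s ^ (d - 1)) * (q \<bar>s\<bar> * indicator {1<..} s) * indicator {0<..} s
      = ennreal (s ^ (d - 1)) * g s / g (\<phi> s) * indicator {1<..} s"
    proof (cases "1 < s")
      case True
      have "q s = g s / g (\<phi> s)"
        using True \<phi>_pos[of s] \<gamma>_pos[of "\<phi> s"] by (simp add: q_def g_eq divide_ennreal)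
      then show ?thesis using True by (simp add: ennreal_times_divide)
    qed simp
  qed
  finally show ?thesis .
qed

lemma G_diff_measurable: "(\<lambda>x. G (y - x)) \<in> borel_measurable borel"
  by measurable

lemma potential_weighted_ball:
  "(\<integral>\<^sup>+x. G (y - x) * (ennreal (weight (r z)) * indicator (ball z (r z)) x) \<partial>lborel) = normalized_potential y z (r z)"
proof -
  have [measurable]: "(\<lambda>x. G (y - x) * indicator (ball z (r z)) x) \<in> borel_measurable borel"
    using G_diff_measurable by (intro borel_measurable_times_ennreal borel_measurable_indicator) auto
  have "(\<integral>\<^sup>+x. G (y - x) * (ennreal (weight (r z)) * indicator (ball z (r z)) x) \<partial>lborel)
    = (\<integral>\<^sup>+x. ennreal (weight (r z)) * (G (y - x) * indicator (ball z (r z)) x) \<partial>lborel)"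
    by (intro nn_integral_cong) (simp add: mult_ac)
  also have "\<dots> = normalized_potential y z (r z)"
    unfolding normalized_potential_def ball_potential_def by (intro nn_integral_cmult) measurable
  finally show ?thesis .
qed

lemma weighted_ball_measurable:
  "(\<lambda>x. ennreal c * indicator (ball z s) x) \<in> borel_measurable borel"
  by (intro borel_measurable_times_ennreal borel_measurable_indicator) auto

text \<open>
  The upper bound for the sums of potentials is uniform in the point, and so is the ratio of the
  leading terms of the upper and lower bounds.  As the integrals over the shells tend to infinity,
  the lower-order terms do not matter and half of that ratio can serve as \<open>\<delta>\<close>.
\<close>

lemma test_densities_if_divergent:
  assumes div: "(\<integral>\<^sup>+s\<in>{1<..}. ennreal (s ^ (d - 1)) * g s / g (\<phi> s) \<partial>lborel) = \<infinity>"
  obtains f :: "nat \<Rightarrow> 'a \<Rightarrow> ennreal" and \<delta> :: real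
  where "\<And>n. f n \<in> borel_measurable borel" "\<And>n y. y \<notin> (\<Union>z\<in>Z. ball z (r z)) \<Longrightarrow> f n y = 0"
    "\<And>n y. (\<integral>\<^sup>+x. G (y - x) * f n x \<partial>lborel) \<le> 1"
    "0 < \<delta>" "\<And>y. \<forall>\<^sub>F n in sequentially. ennreal \<delta> \<le> (\<integral>\<^sup>+x. G (y - x) * f n x \<partial>lborel)"
proof -
  define a where "a = 2 * real near_bound * K"
  define b where "b = 2 * K / inner_volume"
  define b' where "b' = \<omega> * (2*R) ^ d * (C * 2 ^ d)"
  define i where "i n = enn2real (shell (real n))" for n
  \<comment> \<open>The summand \<open>1\<close> keeps \<open>M n\<close> positive even if \<open>a\<close> and \<open>i n\<close> vanish.\<close>
  define M where "M n = a + b * i n + 1" for n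
  define S where "S n y = (\<Sum>z\<in>Z_upto (real n). normalized_potential y z (r z))" for n y
  define f where "f n x = (\<Sum>z\<in>Z_upto (real n). ennreal (weight (r z)) * indicator (ball z (r z)) x) * ennreal (1 / M n)"
    for n and x :: 'a
  have a: "0 \<le> a" and b: "0 < b" and b': "0 < b'"
    using one_le_K inner_volume_pos \<omega>_pos R C by (auto simp: a_def b_def b'_def)
  have i0: "0 \<le> i n" for n by (simp add: i_def)
  have M0: "0 < M n" for n using a b i0[of n] by (simp add: M_def add_nonneg_pos)
  have shell_i: "shell (real n) = ennreal (i n)" for n
    using shell_finite[of "real n"] by (simp add: i_def)
  have S_le: "S n y \<le> ennreal (a + b * i n)" for n y
  proof -
    have "S n y \<le> ennreal a + ennreal b * ennreal (i n)"
      using sum_normalized_potential_le[of y "real n"] by (simp only: S_def a_def b_def shell_i)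
    also have "\<dots> = ennreal (a + b * i n)"
      using a b i0 by (simp add: ennreal_mult ennreal_plus)
    finally show ?thesis .
  qed
  have S_fin: "S n y = ennreal (enn2real (S n y))" for n y
    using order.strict_trans1[OF S_le[of n y] ennreal_less_top] by simp
  have S_real: "enn2real (S n y) \<le> a + b * i n" for n y
    using S_le[of n y] a b i0[of n] by (intro enn2real_leI) auto
  have f_meas: "f n \<in> borel_measurable borel" for n
    unfolding f_def[abs_def]
    by (intro borel_measurable_times_ennreal borel_measurable_sum weighted_ball_measurable) simp
  have pot: "(\<integral>\<^sup>+x. G (y - x) * f n x \<partial>lborel) = ennreal (enn2real (S n y) / M n)" for n y
  proof -
    note [measurable] = G_diff_measurable weighted_ball_measurable
    have "(\<integral>\<^sup>+x. G (y - x) * f n x \<partial>lborel)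
      = (\<integral>\<^sup>+x. (\<Sum>z\<in>Z_upto (real n). G (y - x) * (ennreal (weight (r z)) * indicator (ball z (r z)) x)) * ennreal (1 / M n) \<partial>lborel)"
      by (intro nn_integral_cong) (simp only: f_def sum_distrib_left[symmetric] mult.assoc)
    also have "\<dots> = (\<integral>\<^sup>+x. (\<Sum>z\<in>Z_upto (real n). G (y - x) * (ennreal (weight (r z)) * indicator (ball z (r z)) x)) \<partial>lborel) * ennreal (1 / M n)"
      by (rule nn_integral_multc) measurable
    also have "(\<integral>\<^sup>+x. (\<Sum>z\<in>Z_upto (real n). G (y - x) * (ennreal (weight (r z)) * indicator (ball z (r z)) x)) \<partial>lborel) = S n y"
      unfolding S_def potential_weighted_ball[symmetric] by (rule nn_integral_sum) measurable
    also have "S n y * ennreal (1 / M n) = ennreal (enn2real (S n y) / M n)"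
      using M0[of n] by (subst S_fin) (simp add: ennreal_mult[symmetric])
    finally show ?thesis .
  qed
  have SUP_top: "(SUP n. shell (real n)) = \<infinity>"
    unfolding SUP_shell div using \<omega>_pos by (simp add: ennreal_mult_top d_eq)
  have large: "\<forall>\<^sub>F n in sequentially. B \<le> i n" for B :: real
  proof -
    have "ennreal B < (SUP n. shell (real n))" unfolding SUP_top by simp
    then obtain n0 where "ennreal B < shell (real n0)" by (auto simp: less_SUP_iff)
    then have less: "ennreal B \<le> shell (real n0)" by simp
    have "B \<le> i n" if "n0 \<le> n" for n
      using order_trans[OF less incseqD[OF incseq_shell that]] ennreal_le_iff[OF i0[of n]]
      by (simp only: shell_i)
    then show ?thesis by (auto simp: eventually_sequentially)
  qed
  show thesis
  proof (rule that[of f "1 / (2 * b * b')"])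
    show "f n \<in> borel_measurable borel" for n by (rule f_meas)
    show "f n y = 0" if "y \<notin> (\<Union>z\<in>Z. ball z (r z))" for n y
      using that by (auto simp: f_def Z_upto_def intro!: sum.neutral)
    show "(\<integral>\<^sup>+x. G (y - x) * f n x \<partial>lborel) \<le> 1" for n y
      unfolding pot using S_real[of n y] M0[of n] by (simp add: M_def)
    show "0 < 1 / (2 * b * b')" using b b' by simp
    fix y
    obtain \<kappa> where \<kappa>: "\<kappa> < \<infinity>" "\<And>n. shell n \<le> \<kappa> + ennreal b' * (\<Sum>z\<in>Z_upto n. normalized_potential y z (r z))"
      using shell_le_sum_normalized_potential[of y] unfolding b'_def by blast
    define k where "k = enn2real \<kappa>"
    have k: "\<kappa> = ennreal k" "0 \<le> k" using \<kappa>(1) by (simp_all add: k_def)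
    show "\<forall>\<^sub>F n in sequentially. ennreal (1 / (2 * b * b')) \<le> (\<integral>\<^sup>+x. G (y - x) * f n x \<partial>lborel)"
      \<comment> \<open>This threshold makes \<open>M n \<le> 2 b (i n - k)\<close>, where \<open>i n - k \<le> b' s\<close>.\<close>
      using large[of "2 * k + (a + 1) / b"]
    proof (rule eventually_mono)
      fix n assume n: "2 * k + (a + 1) / b \<le> i n"
      define s where "s = enn2real (S n y)"
      have "ennreal (i n) \<le> ennreal k + ennreal b' * ennreal s"
        using \<kappa>(2)[of "real n"] by (simp only: shell_i k(1) S_def[symmetric] s_def S_fin[symmetric])
      also have "\<dots> = ennreal (k + b' * s)"
        using k b' by (simp add: s_def ennreal_mult ennreal_plus)
      finally have i_le: "i n \<le> k + b' * s"
        using ennreal_le_iff[of "k + b' * s" "i n"] k b' by (simp add: s_def del: ennreal_plus)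
      have "2 * b * k + (a + 1) = b * (2 * k + (a + 1) / b)"
        using b by (simp add: field_simps)
      also have "\<dots> \<le> b * i n"
        using n b by (intro mult_left_mono) auto
      finally have "2 * b * k + (a + 1) \<le> b * i n" .
      then have "M n \<le> 2 * b * (i n - k)" by (simp add: M_def algebra_simps)
      also have "\<dots> \<le> 2 * b * (b' * s)" using i_le b by (intro mult_left_mono) auto
      finally have "1 / (2 * b * b') \<le> s / M n"
        using M0[of n] b b' by (simp add: field_simps)
      then show "ennreal (1 / (2 * b * b')) \<le> (\<integral>\<^sup>+x. G (y - x) * f n x \<partial>lborel)"
        unfolding pot s_def by (rule ennreal_leI)
    qed
  qed
qed

text \<open>
  The upper bound for the finite sums of potentials at the origin carries over to the whole series.
  The factor \<open>C 2\<^sup>d\<close> raises the potential of each ball to at least \<open>1\<close> on that ball.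
\<close>

lemma test_density_if_convergent:
  assumes conv: "(\<integral>\<^sup>+s\<in>{1<..}. ennreal (s ^ (d - 1)) * g s / g (\<phi> s) \<partial>lborel) < \<infinity>"
    and "countable Z"
  obtains f :: "'a \<Rightarrow> ennreal"
  where "f \<in> borel_measurable borel" "(\<integral>\<^sup>+x. G (0 - x) * f x \<partial>lborel) < \<infinity>"
    "\<And>y. y \<in> (\<Union>z\<in>Z. ball z (r z)) \<Longrightarrow> 1 \<le> (\<integral>\<^sup>+x. G (y - x) * f x \<partial>lborel)"
proof -
  define \<zeta> where "\<zeta> = from_nat_into Z"
  have \<zeta>: "bij_betw \<zeta> UNIV Z"
    unfolding \<zeta>_def using assms(2) Z_infinite by (rule bij_betw_from_nat_into)
  then have inj: "inj \<zeta>" and ran: "range \<zeta> = Z" by (simp_all add: bij_betw_def)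
  note [measurable] = G_diff_measurable weighted_ball_measurable
  define h where "h i x = ennreal (weight (r (\<zeta> i))) * indicator (ball (\<zeta> i) (r (\<zeta> i))) x" for i and x :: 'a
  have [measurable]: "h i \<in> borel_measurable borel" for i
    unfolding h_def[abs_def] by measurable
  define f where "f x = ennreal (C * 2 ^ d) * (\<Sum>i. h i x)" for x
  have f_meas[measurable]: "f \<in> borel_measurable borel"
    unfolding f_def[abs_def] by measurable
  have pot: "(\<integral>\<^sup>+x. G (y - x) * f x \<partial>lborel) = ennreal (C * 2 ^ d) * (\<Sum>i. normalized_potential y (\<zeta> i) (r (\<zeta> i)))" for y
  proof -
    have "(\<integral>\<^sup>+x. G (y - x) * f x \<partial>lborel) = (\<integral>\<^sup>+x. ennreal (C * 2 ^ d) * (\<Sum>i. G (y - x) * h i x) \<partial>lborel)"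
      by (intro nn_integral_cong) (simp add: f_def mult.left_commute)
    also have "\<dots> = ennreal (C * 2 ^ d) * (\<integral>\<^sup>+x. (\<Sum>i. G (y - x) * h i x) \<partial>lborel)"
      by (rule nn_integral_cmult) measurable
    also have "(\<integral>\<^sup>+x. (\<Sum>i. G (y - x) * h i x) \<partial>lborel) = (\<Sum>i. \<integral>\<^sup>+x. G (y - x) * h i x \<partial>lborel)"
      by (rule nn_integral_suminf) measurable
    finally show ?thesis by (simp add: h_def potential_weighted_ball)
  qed
  define T where "T = (SUP n. shell (real n))"
  have T: "T < \<infinity>"
    unfolding T_def SUP_shell using conv by (simp add: ennreal_mult_less_top)
  have "(\<Sum>i. normalized_potential 0 (\<zeta> i) (r (\<zeta> i))) \<le> ennreal (2 * real near_bound * K) + ennreal (2 * K / inner_volume) * T"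
    unfolding suminf_eq_SUP
  proof (rule SUP_least)
    fix k
    obtain n :: nat where n: "\<And>i. i < k \<Longrightarrow> norm (\<zeta> i) \<le> real n"
    proof -
      obtain n :: nat where "Max (insert 0 ((\<lambda>i. norm (\<zeta> i)) ` {..<k})) \<le> real n"
        using real_arch_simple by blast
      then show thesis by (intro that[of n]) (auto simp: Max_le_iff)
    qed
    have "(\<Sum>i<k. normalized_potential 0 (\<zeta> i) (r (\<zeta> i))) = (\<Sum>z\<in>\<zeta> ` {..<k}. normalized_potential 0 z (r z))"
      using inj by (subst sum.reindex) (auto intro: inj_on_subset)
    also have "\<dots> \<le> (\<Sum>z\<in>Z_upto (real n). normalized_potential 0 z (r z))"
      using finite_Z_upto[of "real n"] n ran by (intro sum_mono2) (auto simp: Z_upto_def)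
    also have "\<dots> \<le> ennreal (2 * real near_bound * K) + ennreal (2 * K / inner_volume) * shell (real n)"
      by (rule sum_normalized_potential_le)
    also have "\<dots> \<le> ennreal (2 * real near_bound * K) + ennreal (2 * K / inner_volume) * T"
      unfolding T_def by (intro add_left_mono mult_left_mono SUP_upper) auto
    finally show "(\<Sum>i<k. normalized_potential 0 (\<zeta> i) (r (\<zeta> i))) \<le> ennreal (2 * real near_bound * K) + ennreal (2 * K / inner_volume) * T" .
  qed
  also have "\<dots> < \<infinity>" using T by (simp add: ennreal_mult_less_top)
  finally have fin: "(\<integral>\<^sup>+x. G (0 - x) * f x \<partial>lborel) < \<infinity>"
    unfolding pot by (simp add: ennreal_mult_less_top)
  show thesis
  proof (rule that[OF f_meas fin])
    fix y assume "y \<in> (\<Union>z\<in>Z. ball z (r z))"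
    then obtain z where z: "z \<in> Z" "y \<in> ball z (r z)" by blast
    then obtain i where i: "z = \<zeta> i" using ran by auto
    have "1 \<le> ennreal (C * 2 ^ d) * normalized_potential y (\<zeta> i) (r (\<zeta> i))"
      using normalized_potential_on_ball[OF radii[OF z(1)] z(2)] by (simp add: i)
    also have "\<dots> \<le> ennreal (C * 2 ^ d) * (\<Sum>i. normalized_potential y (\<zeta> i) (r (\<zeta> i)))"
      using sum_le_suminf[of "\<lambda>i. normalized_potential y (\<zeta> i) (r (\<zeta> i))" "{i}"]
      by (intro mult_left_mono) auto
    finally show "1 \<le> (\<integral>\<^sup>+x. G (y - x) * f x \<partial>lborel)" unfolding pot .
  qed
qed

end


section \<open>The criterion\<close>

theorem corollary1p3:
  fixes P :: "real \<Rightarrow> 'a::euclidean_space \<Rightarrow> 'a measure"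
    and g :: "real \<Rightarrow> ennreal"
    and R\<^sub>0 :: real
    and \<Omega> :: "'w set" and F :: "ennreal \<Rightarrow> 'w measure"
    and X :: "ennreal \<Rightarrow> 'w \<Rightarrow> 'a option" and \<theta> :: "ennreal \<Rightarrow> 'w \<Rightarrow> 'w"
    and Pr :: "'a option \<Rightarrow> 'w measure"
    and Z :: "'a set" and r :: "'a \<Rightarrow> real" and \<phi> :: "real \<Rightarrow> real"
  assumes semigroup: "right_continuous_markov_semigroup P"
    and g_decreasing: "antimono_on {0..} g"
    and g_pos_finite: "\<And>s. s > 0 \<Longrightarrow> 0 < g s \<and> g s < \<infinity>"
    and g_zero: "g 0 = \<infinity>" "(g \<longlongrightarrow> g 0) (at_right 0)"
    and G_excessive: "excessive P (\<lambda>x. g (norm x))"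
    and G_potential: "\<And>f x. f \<in> borel_measurable borel \<Longrightarrow>
          potential P f x = (\<integral>\<^sup>+y. g (norm (x - y)) * f y \<partial>lborel)"
    and LD: "LD DIM('a) R\<^sub>0 g"
    and UD: "UD g"
    and hunt: "hunt_process \<Omega> F X \<theta> Pr"
    and transition: "has_transition_semigroup X Pr P"
    and Z_countable: "countable Z" and Z_nonzero: "Z \<subseteq> UNIV - {0}"
    and radii: "\<And>z. z \<in> Z \<Longrightarrow> r z > R\<^sub>0"
    and balls_disjoint: "disjoint_family_on (\<lambda>z. ball z (r z)) Z"
    and separated: "\<exists>\<epsilon>>0. \<forall>z\<in>Z. \<forall>z'\<in>Z. z \<noteq> z' \<longrightarrow> norm (z - z') \<ge> \<epsilon>"
    and relatively_dense: "\<exists>R>0. \<forall>x. ball x R \<inter> Z \<noteq> {}"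
    and phi_decreasing: "antimono_on {0..} \<phi>"
    and phi_pos: "\<And>t. t \<ge> 0 \<Longrightarrow> \<phi> t > 0"
    and radii_phi: "\<And>z. z \<in> Z \<Longrightarrow> r z = \<phi> (norm z)"
  shows "unavoidable X Pr (\<Union>z\<in>Z. ball z (r z)) \<longleftrightarrow>
    (\<integral>\<^sup>+s\<in>{1<..}. ennreal (s ^ (DIM('a) - 1)) * g s / g (\<phi> s) \<partial>lborel) = \<infinity>"
proof -
  obtain C where C: "1 \<le> C" "0 \<le> R\<^sub>0" "\<And>r. r > R\<^sub>0 \<Longrightarrow>
      of_nat DIM('a) * (\<integral>\<^sup>+s\<in>{0<..<r}. ennreal (s ^ (DIM('a) - 1)) * g s \<partial>lborel)
        \<le> ennreal (C * r ^ DIM('a)) * g r"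
    using LD by (auto simp: LD_def)
  obtain \<epsilon> where \<epsilon>: "0 < \<epsilon>" "separated_by \<epsilon> Z"
    using separated unfolding separated_by_def by blast
  obtain R where R: "0 < R" "\<And>x. ball x R \<inter> Z \<noteq> {}"
    using relatively_dense by blast
  let ?G = "\<lambda>x::'a. g (norm x)"
  have G: "?G \<in> borel_measurable borel"
    using G_excessive by (simp add: excessive_def)
  interpret hunt_markov \<Omega> F X \<theta> Pr P
    using hunt semigroup transition by (intro hunt_markov.intro hunt_markov_axioms.intro)
  interpret regular_balls ?G g R\<^sub>0 C "DIM('a)" "unit_ball_vol (real DIM('a))" "C * 3 ^ DIM('a)" Z r \<phi> \<epsilon> R
    using C G g_decreasing g_pos_finite Z_nonzero radii \<epsilon> R phi_decreasing phi_pos radii_phi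
    by unfold_locales auto
  let ?A = "\<Union>z\<in>Z. ball z (r z)"
  let ?J = "\<integral>\<^sup>+s\<in>{1<..}. ennreal (s ^ (DIM('a) - 1)) * g s / g (\<phi> s) \<partial>lborel"
  have A: "open ?A" by auto
  show ?thesis
  proof
    assume J: "?J = \<infinity>"
    obtain f \<delta> where f: "\<And>n. f n \<in> borel_measurable borel" "\<And>n y. y \<notin> ?A \<Longrightarrow> f n y = 0"
      "\<And>n y. (\<integral>\<^sup>+x. ?G (y - x) * f n x \<partial>lborel) \<le> 1"
      "0 < \<delta>" "\<And>y. \<forall>\<^sub>F n in sequentially. ennreal \<delta> \<le> (\<integral>\<^sup>+x. ?G (y - x) * f n x \<partial>lborel)"
      using test_densities_if_divergent[OF J] by blast
    have "AE \<omega> in law x. \<omega> \<in> dyadic_hit ?A 0" for x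
      using f by (intro hits_almost_surely[OF A f(1,2) _ f(4)]) (auto simp: G_potential)
    then show "unavoidable X Pr ?A"
      by (simp only: unavoidable_iff_dyadic[OF A] simp_thms)
  next
    assume un: "unavoidable X Pr ?A"
    show "?J = \<infinity>"
    proof (rule ccontr)
      assume "?J \<noteq> \<infinity>"
      then have J: "?J < \<infinity>" by (simp add: less_top)
      obtain f where f: "f \<in> borel_measurable borel" "(\<integral>\<^sup>+x. ?G (0 - x) * f x \<partial>lborel) < \<infinity>"
        "\<And>y. y \<in> ?A \<Longrightarrow> 1 \<le> (\<integral>\<^sup>+x. ?G (y - x) * f x \<partial>lborel)"
        using test_density_if_convergent[OF J Z_countable] by blast
      obtain y where y: "potential P f y < 1"
        using exists_potential_less_1[OF f(1), of 0] f by (auto simp: G_potential)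
      have A': "?A \<in> sets borel" using A by simp
      have "emeasure (law y) (dyadic_hit ?A 0) \<le> potential P f y"
        using f A' by (intro hit_le_potential) (auto simp: G_potential)
      moreover have "AE \<omega> in law y. \<omega> \<in> dyadic_hit ?A 0"
        using un unavoidable_iff_dyadic[OF A] by blast
      then have "emeasure (law y) (dyadic_hit ?A 0) = 1"
        using prob_space.emeasure_eq_1_AE[OF prob_space_Pr dyadic_hit_sets[OF A']] by simp
      ultimately show False using y by simp
    qed
  qed
qed

end
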